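(* Let $\mathbf{\Sigma}$ be a nice topological pointclass, and assume that $\mathsf{Det}(\mathbf{\Sigma}(\omega^\omega))$ holds. Let $Z$ be an uncountable zero-dimensional Polish space, let $\xi<\omega_1$, and let $\mathbf{\Gamma}\in\mathsf{NSD}_{\mathbf{\Sigma}}(Z)$. Assume that $\ell(\mathbf{\Gamma})=\eta<\omega_1$. Then $$\ell(\mathbf{\Gamma}^{(\xi)})=\xi+\eta.$$
   Context: Work in $\mathsf{ZF}+\mathsf{DC}$. "Space" means separable metrizable topological space. A space is zero-dimensional if it is non-empty and has a base of clopen sets. Determinacy: a set $S\subseteq\omega^\omega$ is determined if one of the players has a winning strategy in the game where I and II alternately play $x_0,y_0,x_1,y_1,\ldots\in\omega$ and I wins iff $(x_0,y_0,x_1,y_1,\ldots)\in S$. $\mathsf{Det}(\mathcal{S})$ means every element of $\mathcal{S}\subseteq\mathcal{P}(\omega^\omega)$ is determined. Pointclasses: a topological pointclass is a function $\mathbf{\Sigma}$ assigning to each space $Z$ a collection $\mathbf{\Sigma}(Z)\subseteq\mathcal{P}(Z)$ such that $f^{-1}[B]\in\mathbf{\Sigma}(Z)$ whenever $f:Z\to W$ is continuous and $B\in\mathbf{\Sigma}(W)$. A Borel space is a space homeomorphic to a Borel subset of a Polish space. $\mathbf{\Sigma}$ is nice if moreover, for every space $Z$: every Borel subset of $Z$ is in $\mathbf{\Sigma}(Z)$; $\mathbf{\Sigma}(Z)$ is a Boolean subalgebra of $\mathcal{P}(Z)$; $f^{-1}[B]\in\mathbf{\Sigma}(Z)$ whenever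 $f:Z\to W$ is a Borel function and $B\in\mathbf{\Sigma}(W)$; and if $j[Z]\in\mathbf{\Sigma}(W)$ for some Borel space $W$ and embedding $j:Z\to W$, then $i[Z]\in\mathbf{\Sigma}(W)$ for every Borel space $W$ and embedding $i:Z\to W$. Wadge classes: for $\mathbf{\Gamma}\subseteq\mathcal{P}(Z)$, the dual is $\check{\mathbf{\Gamma}}=\{Z\setminus A:A\in\mathbf{\Gamma}\}$; $\mathbf{\Gamma}$ is selfdual if $\mathbf{\Gamma}=\check{\mathbf{\Gamma}}$. A Wadge class in $Z$ is a collection of the form $\{f^{-1}[A]:f:Z\to Z\text{ continuous}\}$ for some $A\subseteq Z$. $\mathsf{NSD}(Z)$ is the set of all non-selfdual Wadge classes in $Z$, and $\mathsf{NSD}_{\mathbf{\Sigma}}(Z)=\{\mathbf{\Gamma}\in\mathsf{NSD}(Z):\mathbf{\Gamma}\subseteq\mathbf{\Sigma}(Z)\}$. Level: for $\xi<\omega_1$, $\mathsf{PU}_\xi(\mathbf{\Gamma})$ is the collection of all sets $\bigcup_{n\in\omega}(A_n\cap V_n)$ with $A_n\in\mathbf{\Gamma}$ and $V_n\in\mathbf{\Delta}^0_{1+\xi}(Z)$ pairwise disjoint with $\bigcup_n V_n=Z$. Write $\ell(\mathbf{\Gamma})\geq\xi$ if $\mathsf{PU}_\xi(\mathbf{\Gamma})=\mathbf{\Gamma}$; $\ell(\mathbf{\Gamma})=\xi$ if $\ell(\mathbf{\Gamma})\geq\xi$ and not $\ell(\mathbf{\Gamma})\geq\xi+1$. Expansions: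 a function $f:Z\to Z$ is $\mathbf{\Sigma}^0_{1+\xi}$-measurable if $f^{-1}[U]\in\mathbf{\Sigma}^0_{1+\xi}(Z)$ for every open $U\subseteq Z$. For $\mathbf{\Gamma}\subseteq\mathcal{P}(Z)$, $\mathbf{\Gamma}^{(\xi)}=\{f^{-1}[A]:A\in\mathbf{\Gamma}\text{ and }f:Z\to Z\text{ is }\mathbf{\Sigma}^0_{1+\xi}\text{-measurable}\}$. *)

theory Defs
  imports "HOL-Analysis.Analysis"
begin

section \<open>Countable ordinals\<close>

text \<open>
  The elements of \<open>omega1\<close> are exactly the ordinals below the first uncountable one: the type is
  a wellorder, it is uncountable, and all of its proper initial segments are countable (see
  \<open>countable_lessThan_omega1\<close> and \<open>uncountable_omega1\<close>).
\<close>

typedef omega1 = "Field (cardSuc natLeq)"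
proof -
  have "infinite (Field (cardSuc natLeq))"
    using cardSuc_finite[OF natLeq_Card_order] by (simp add: Field_natLeq)
  then show ?thesis
    by (metis all_not_in_conv finite.emptyI)
qed

lemma Well_order_cardSuc_natLeq: "Well_order (cardSuc natLeq)"
  using cardSuc_Card_order[OF natLeq_Card_order] card_order_on_def by blast

instantiation omega1 :: linorder
begin

definition less_eq_omega1 :: "omega1 \<Rightarrow> omega1 \<Rightarrow> bool"
  where "a \<le> b \<longleftrightarrow> (Rep_omega1 a, Rep_omega1 b) \<in> cardSuc natLeq"

definition less_omega1 :: "omega1 \<Rightarrow> omega1 \<Rightarrow> bool"
  where "a < b \<longleftrightarrow> a \<le> b \<and> \<not> b \<le> a" for a b :: omega1

instance
proof
  have w: "wo_rel (cardSuc natLeq)"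
    using Well_order_cardSuc_natLeq by (simp add: wo_rel_def)
  fix x y z :: omega1
  show "(x < y) = (x \<le> y \<and> \<not> y \<le> x)"
    by (simp add: less_omega1_def)
  show "x \<le> x"
    using wo_rel.REFL[OF w] Rep_omega1[of x] by (auto simp: less_eq_omega1_def refl_on_def)
  show "x \<le> y \<Longrightarrow> y \<le> z \<Longrightarrow> x \<le> z"
    using wo_rel.TRANS[OF w] by (auto simp: less_eq_omega1_def dest: transD)
  show "x \<le> y \<Longrightarrow> y \<le> x \<Longrightarrow> x = y"
    using wo_rel.ANTISYM[OF w] by (metis less_eq_omega1_def Rep_omega1_inject antisymD)
  show "x \<le> y \<or> y \<le> x"
    using wo_rel.TOTALS[OF w] Rep_omega1 by (auto simp: less_eq_omega1_def)
qed

end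

lemma wf_less_omega1: "wf {(a, b :: omega1). a < b}"
proof -
  have "wf (cardSuc natLeq - Id)"
    using Well_order_cardSuc_natLeq by (simp add: well_order_on_def)
  then have "wf (inv_image (cardSuc natLeq - Id) Rep_omega1)"
    by (rule wf_inv_image)
  moreover have "{(a, b :: omega1). a < b} \<subseteq> inv_image (cardSuc natLeq - Id) Rep_omega1"
    by (auto simp: inv_image_def less_le less_eq_omega1_def Rep_omega1_inject)
  ultimately show ?thesis
    by (rule wf_subset)
qed

instance omega1 :: wellorder
proof
  fix P :: "omega1 \<Rightarrow> bool" and a
  assume "\<And>x. (\<And>y. y < x \<Longrightarrow> P y) \<Longrightarrow> P x"
  then show "P a"
    using wf_induct[OF wf_less_omega1, of P a] by blast
qed

lemma countable_if_ordLeq_natLeq: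
  includes cardinal_syntax
  assumes "|A| \<le>o natLeq"
  shows "countable A"
proof -
  have "|A| \<le>o |UNIV :: nat set|"
    using assms ordIso_symmetric[OF card_of_nat] by (rule ordLeq_ordIso_trans)
  then show ?thesis
    by (auto simp: card_of_ordLeq[symmetric] countable_def)
qed

lemma ordLeq_natLeq_if_countable:
  includes cardinal_syntax
  assumes "countable A"
  shows "|A| \<le>o natLeq"
proof -
  have "|A| \<le>o |UNIV :: nat set|"
    using assms by (auto simp: card_of_ordLeq[symmetric] countable_def)
  then show ?thesis
    using card_of_nat by (rule ordLeq_ordIso_trans)
qed

lemma countable_lessThan_omega1:
  includes cardinal_syntax
  shows "countable {..<a :: omega1}"
proof -
  let ?r = "cardSuc natLeq"
  have "Card_order ?r"
    by (rule cardSuc_Card_order[OF natLeq_Card_order])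
  then have "|underS ?r (Rep_omega1 a)| <o ?r"
    using Rep_omega1 by (rule card_of_underS)
  then have "|underS ?r (Rep_omega1 a)| \<le>o natLeq"
    by (rule cardSuc_ordLeq_ordLess[OF natLeq_Card_order card_of_Card_order, THEN iffD1])
  then have "countable (underS ?r (Rep_omega1 a))"
    by (rule countable_if_ordLeq_natLeq)
  moreover have "Rep_omega1 ` {..<a} \<subseteq> underS ?r (Rep_omega1 a)"
    by (auto simp: underS_def less_le less_eq_omega1_def Rep_omega1_inject)
  ultimately have "countable (Rep_omega1 ` {..<a})"
    by (rule countable_subset[rotated])
  then show ?thesis
    by (rule countable_image_inj_on) (simp add: inj_on_def Rep_omega1_inject)
qed

lemma uncountable_omega1:
  includes cardinal_syntax
  shows "uncountable (UNIV :: omega1 set)"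
proof
  assume "countable (UNIV :: omega1 set)"
  then have "countable (range Rep_omega1)"
    by blast
  then have "countable (Field (cardSuc natLeq))"
    by (simp add: type_definition.Rep_range[OF type_definition_omega1])
  then have "|Field (cardSuc natLeq)| \<le>o natLeq"
    by (rule ordLeq_natLeq_if_countable)
  then have "cardSuc natLeq \<le>o natLeq"
    by (rule ordIso_ordLeq_trans[OF ordIso_symmetric[OF
          card_of_Field_ordIso[OF cardSuc_Card_order[OF natLeq_Card_order]]]])
  then show False
    using cardSuc_greater[OF natLeq_Card_order] not_ordLess_ordLeq by blast
qed

lemma countable_bounded_omega1:
  assumes "countable (A :: omega1 set)"
  shows "\<exists>b. \<forall>a\<in>A. a < b"
proof (rule ccontr)
  assume *: "\<nexists>b. \<forall>a\<in>A. a < b"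
  then have "UNIV \<subseteq> (\<Union>a\<in>A. insert a {..<a})"
    by (force simp: not_less le_less)
  moreover have "countable (\<Union>a\<in>A. insert a {..<a})"
    using assms countable_lessThan_omega1 by (intro countable_UN) auto
  ultimately show False
    using uncountable_omega1 countable_subset by blast
qed

text \<open>
  Ordinal addition: \<open>a + b = sup ({a} \<union> {(a + b') + 1 | b' < b})\<close>, so \<open>a + 0 = a\<close>,
  \<open>a + (b + 1) = (a + b) + 1\<close>, with suprema at limits. It is not commutative.
\<close>

instantiation omega1 :: "{zero, one, plus}"
begin

definition zero_omega1 :: omega1
  where "0 = (LEAST c :: omega1. True)"

definition one_omega1 :: omega1
  where "1 = (LEAST c :: omega1. 0 < c)"

function plus_omega1 :: "omega1 \<Rightarrow> omega1 \<Rightarrow> omega1"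
  where "plus_omega1 a b = (LEAST c. a \<le> c \<and> (\<forall>b'\<in>{..<b}. plus_omega1 a b' < c))"
  by auto
termination
  by (relation "inv_image {(a, b :: omega1). a < b} snd") (auto intro: wf_less_omega1)

instance ..

end

declare plus_omega1.simps [simp del]

lemma zero_le_omega1: "0 \<le> (a :: omega1)"
  by (simp add: zero_omega1_def Least_le)

lemma one_le_iff_omega1: "1 \<le> a \<longleftrightarrow> 0 < (a :: omega1)"
proof -
  obtain b :: omega1 where "0 < b"
    using countable_bounded_omega1[of "{0}"] by auto
  then have "0 < (1 :: omega1)"
    unfolding one_omega1_def by (rule LeastI)
  then show ?thesis
    using Least_le[of "\<lambda>c. 0 < c" a] by (auto simp: one_omega1_def[symmetric])
qed

lemma plus_omega1_bound:
  "a \<le> a + b \<and> (\<forall>b'\<in>{..<b}. a + b' < a + b)" for a b :: omega1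
proof -
  have "countable (insert a ((+) a ` {..<b}))"
    using countable_lessThan_omega1 by simp
  then obtain c where "\<forall>x\<in>insert a ((+) a ` {..<b}). x < c"
    using countable_bounded_omega1 by blast
  then have "a \<le> c \<and> (\<forall>b'\<in>{..<b}. a + b' < c)"
    by auto
  then show ?thesis
    unfolding plus_omega1.simps[of a b] by (rule LeastI)
qed

lemma plus_omega1_least:
  "a \<le> c \<Longrightarrow> (\<And>b'. b' < b \<Longrightarrow> a + b' < c) \<Longrightarrow> a + b \<le> c" for a b c :: omega1
  unfolding plus_omega1.simps[of a b] by (rule Least_le) auto

lemma plus_zero_omega1: "a + 0 = a" for a :: omega1
proof (rule antisym)
  show "a + 0 \<le> a"
    by (rule plus_omega1_least) (use zero_le_omega1 leD in \<open>blast+\<close>)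
  show "a \<le> a + 0"
    using plus_omega1_bound[of a 0] by blast
qed

lemma less_plus_one_omega1: "a < b + 1 \<longleftrightarrow> a \<le> b" for a b :: omega1
proof
  have lt1: "b' = 0" if "b' < 1" for b' :: omega1
    using that one_le_iff_omega1[of b'] zero_le_omega1[of b'] by auto
  show "a \<le> b" if "a < b + 1"
  proof (rule ccontr)
    assume "\<not> a \<le> b"
    then have "b + 1 \<le> a"
      by (intro plus_omega1_least) (auto dest!: lt1 simp: plus_zero_omega1)
    then show False
      using that by simp
  qed
  have "b + 0 < b + 1"
    using plus_omega1_bound[of b 1] one_le_iff_omega1[of 1] by auto
  then show "a \<le> b \<Longrightarrow> a < b + 1"
    by (simp add: plus_zero_omega1)
qed

lemma plus_succ_omega1: "a + (b + 1) = (a + b) + 1" for a b :: omega1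
proof (rule antisym)
  have mono: "a + b' \<le> a + b" if "b' \<le> b" for b'
    using that plus_omega1_bound[of a b] by (auto simp: le_less)
  show "a + (b + 1) \<le> (a + b) + 1"
    using plus_omega1_bound[of a b] mono
    by (intro plus_omega1_least) (auto simp: less_plus_one_omega1 intro: less_imp_le)
  have "a + b < a + (b + 1)"
    using plus_omega1_bound[of a "b + 1"] by (auto simp: less_plus_one_omega1)
  then show "(a + b) + 1 \<le> a + (b + 1)"
    by (metis less_plus_one_omega1 not_le)
qed


section \<open>Spaces\<close>

definition sep_metrizable :: "'a topology \<Rightarrow> bool"
  where "sep_metrizable Z \<longleftrightarrow> separable_space Z \<and> metrizable_space Z"

definition polish :: "'a topology \<Rightarrow> bool"
  where "polish Z \<longleftrightarrow> separable_space Z \<and> completely_metrizable_space Z"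

definition zero_dimensional :: "'a topology \<Rightarrow> bool"
  where "zero_dimensional Z \<longleftrightarrow> topspace Z \<noteq> {} \<and>
    (\<exists>\<B>. (\<forall>V\<in>\<B>. openin Z V \<and> closedin Z V) \<and>
         (\<forall>U x. openin Z U \<and> x \<in> U \<longrightarrow> (\<exists>V\<in>\<B>. x \<in> V \<and> V \<subseteq> U)))"

definition borel_of :: "'a topology \<Rightarrow> 'a measure"
  where "borel_of Z = sigma (topspace Z) {U. openin Z U}"

definition borel_space :: "'a topology \<Rightarrow> bool"
  where "borel_space Z \<longleftrightarrow>
    (\<exists>(P :: 'a topology) B. polish P \<and> B \<in> sets (borel_of P) \<and> Z homeomorphic_space subtopology P B)"

definition baire_space :: "(nat \<Rightarrow> nat) topology"
  where "baire_space = product_topology (\<lambda>_. discrete_topology UNIV) UNIV"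


section \<open>Topological pointclasses\<close>

text \<open>
  A pointclass ranges over the separable metrizable topologies whose points come from a fixed but
  arbitrary type \<open>'a\<close>. Such spaces have at most continuum many points, so as soon as \<open>'a\<close> has
  continuum many elements (in particular if it carries an uncountable Polish space) every separable
  metrizable space has a homeomorphic copy over \<open>'a\<close>. As membership is invariant under
  homeomorphisms, nothing is lost.
\<close>

definition topological_pointclass :: "('a topology \<Rightarrow> 'a set set) \<Rightarrow> bool"
  where "topological_pointclass \<Sigma> \<longleftrightarrow>
    (\<forall>Z. sep_metrizable Z \<longrightarrow> \<Sigma> Z \<subseteq> Pow (topspace Z)) \<and>
    (\<forall>Z W f B. sep_metrizable Z \<and> sep_metrizable W \<and> continuous_map Z W f \<and> B \<in> \<Sigma> W
      \<longrightarrow> f -` B \<inter> topspace Z \<in> \<Sigma> Z)"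

definition nice_pointclass :: "('a topology \<Rightarrow> 'a set set) \<Rightarrow> bool"
  where "nice_pointclass \<Sigma> \<longleftrightarrow> topological_pointclass \<Sigma> \<and>
    (\<forall>Z. sep_metrizable Z \<longrightarrow> sets (borel_of Z) \<subseteq> \<Sigma> Z) \<and>
    (\<forall>Z. sep_metrizable Z \<longrightarrow> algebra (topspace Z) (\<Sigma> Z)) \<and>
    (\<forall>Z W f B. sep_metrizable Z \<and> sep_metrizable W \<and> f \<in> borel_of Z \<rightarrow>\<^sub>M borel_of W \<and> B \<in> \<Sigma> W
      \<longrightarrow> f -` B \<inter> topspace Z \<in> \<Sigma> Z) \<and>
    (\<forall>Z :: 'a topology. sep_metrizable Z \<and>
        (\<exists>(W :: 'a topology) j. borel_space W \<and> embedding_map Z W j \<and> j ` topspace Z \<in> \<Sigma> W)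
      \<longrightarrow> (\<forall>(W :: 'a topology) i. borel_space W \<and> embedding_map Z W i \<longrightarrow> i ` topspace Z \<in> \<Sigma> W))"

text \<open>
  The value of a pointclass at the Baire space, read off from copies of the Baire space over \<open>'a\<close>;
  the choice of the copy is immaterial.
\<close>

definition baire_sets :: "('a topology \<Rightarrow> 'a set set) \<Rightarrow> (nat \<Rightarrow> nat) set set"
  where "baire_sets \<Sigma> =
    {S. \<exists>(W :: 'a topology) h. homeomorphic_map baire_space W h \<and> h ` S \<in> \<Sigma> W}"


section \<open>Determinacy\<close>

text \<open>
  The run of the game is \<open>z = (x\<^sub>0, y\<^sub>0, x\<^sub>1, y\<^sub>1, \<dots>)\<close>, so player I moves at even and player II at odd
  positions. A strategy maps the finite sequence of all previous moves to the next move.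
\<close>

definition wins_I :: "(nat list \<Rightarrow> nat) \<Rightarrow> (nat \<Rightarrow> nat) set \<Rightarrow> bool"
  where "wins_I \<sigma> S \<longleftrightarrow> (\<forall>z. (\<forall>n. z (2 * n) = \<sigma> (map z [0..<2 * n])) \<longrightarrow> z \<in> S)"

definition wins_II :: "(nat list \<Rightarrow> nat) \<Rightarrow> (nat \<Rightarrow> nat) set \<Rightarrow> bool"
  where "wins_II \<tau> S \<longleftrightarrow> (\<forall>z. (\<forall>n. z (2 * n + 1) = \<tau> (map z [0..<2 * n + 1])) \<longrightarrow> z \<notin> S)"

definition determined :: "(nat \<Rightarrow> nat) set \<Rightarrow> bool"
  where "determined S \<longleftrightarrow> (\<exists>\<sigma>. wins_I \<sigma> S) \<or> (\<exists>\<tau>. wins_II \<tau> S)"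

definition Det :: "(nat \<Rightarrow> nat) set set \<Rightarrow> bool"
  where "Det \<S> \<longleftrightarrow> (\<forall>S\<in>\<S>. determined S)"


section \<open>Wadge classes\<close>

definition dual_class :: "'a topology \<Rightarrow> 'a set set \<Rightarrow> 'a set set"
  where "dual_class Z \<Gamma> = {topspace Z - A | A. A \<in> \<Gamma>}"

definition wadge_class :: "'a topology \<Rightarrow> 'a set set \<Rightarrow> bool"
  where "wadge_class Z \<Gamma> \<longleftrightarrow>
    (\<exists>A. A \<subseteq> topspace Z \<and> \<Gamma> = {f -` A \<inter> topspace Z | f. continuous_map Z Z f})"

definition NSD :: "'a topology \<Rightarrow> 'a set set set"
  where "NSD Z = {\<Gamma>. wadge_class Z \<Gamma> \<and> \<Gamma> \<noteq> dual_class Z \<Gamma>}"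

definition NSD_in :: "('a topology \<Rightarrow> 'a set set) \<Rightarrow> 'a topology \<Rightarrow> 'a set set set"
  where "NSD_in \<Sigma> Z = {\<Gamma> \<in> NSD Z. \<Gamma> \<subseteq> \<Sigma> Z}"


section \<open>Borel hierarchy, level and expansions\<close>

text \<open>
  \<open>is_Sigma0 Z \<alpha> A\<close> means \<open>A \<in> \<Sigma>\<^sup>0\<^sub>\<alpha>(Z)\<close>, for \<open>\<alpha> \<ge> 1\<close>: open sets for \<open>\<alpha> = 1\<close>, and countable unions of
  complements of \<open>\<Sigma>\<^sup>0\<^sub>\<beta>\<close> sets with \<open>1 \<le> \<beta> < \<alpha>\<close> for \<open>\<alpha> > 1\<close>. No set is of class \<open>0\<close>, so the condition
  \<open>1 \<le> \<beta>\<close> is automatic.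
\<close>

inductive is_Sigma0 :: "'a topology \<Rightarrow> omega1 \<Rightarrow> 'a set \<Rightarrow> bool" for Z
  where
    open_set: "openin Z U \<Longrightarrow> is_Sigma0 Z 1 U"
  | union: "(\<And>n :: nat. \<beta> n < \<alpha> \<and> is_Sigma0 Z (\<beta> n) (B n))
      \<Longrightarrow> is_Sigma0 Z \<alpha> (\<Union>n. topspace Z - B n)"

definition Sigma0 :: "omega1 \<Rightarrow> 'a topology \<Rightarrow> 'a set set"
  where "Sigma0 \<alpha> Z = {A. is_Sigma0 Z \<alpha> A}"

definition Delta0 :: "omega1 \<Rightarrow> 'a topology \<Rightarrow> 'a set set"
  where "Delta0 \<alpha> Z = {A. A \<in> Sigma0 \<alpha> Z \<and> topspace Z - A \<in> Sigma0 \<alpha> Z}"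

definition PU :: "'a topology \<Rightarrow> omega1 \<Rightarrow> 'a set set \<Rightarrow> 'a set set"
  where "PU Z \<xi> \<Gamma> = {\<Union>n :: nat. A n \<inter> V n | A V.
    (\<forall>n. A n \<in> \<Gamma>) \<and> (\<forall>n. V n \<in> Delta0 (1 + \<xi>) Z) \<and> disjoint_family V \<and> (\<Union>n. V n) = topspace Z}"

definition level_ge :: "'a topology \<Rightarrow> 'a set set \<Rightarrow> omega1 \<Rightarrow> bool"
  where "level_ge Z \<Gamma> \<xi> \<longleftrightarrow> PU Z \<xi> \<Gamma> = \<Gamma>"

definition level_eq :: "'a topology \<Rightarrow> 'a set set \<Rightarrow> omega1 \<Rightarrow> bool"
  where "level_eq Z \<Gamma> \<xi> \<longleftrightarrow> level_ge Z \<Gamma> \<xi> \<and> \<not> level_ge Z \<Gamma> (\<xi> + 1)"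

definition Sigma0_measurable :: "omega1 \<Rightarrow> 'a topology \<Rightarrow> ('a \<Rightarrow> 'a) \<Rightarrow> bool"
  where "Sigma0_measurable \<alpha> Z f \<longleftrightarrow>
    f \<in> topspace Z \<rightarrow> topspace Z \<and> (\<forall>U. openin Z U \<longrightarrow> f -` U \<inter> topspace Z \<in> Sigma0 \<alpha> Z)"

definition expansion :: "'a topology \<Rightarrow> omega1 \<Rightarrow> 'a set set \<Rightarrow> 'a set set"
  where "expansion Z \<xi> \<Gamma> =
    {f -` A \<inter> topspace Z | A f. A \<in> \<Gamma> \<and> Sigma0_measurable (1 + \<xi>) Z f}"

end

theory Submission
  imports Defs
begin

text \<open>
  Fix \<open>A\<close> generating the non-selfdual class \<open>\<Gamma>\<close>; we show that \<open>\<Gamma>\<close> has level at least \<open>\<eta>\<close> iff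
  \<open>\<Gamma>\<^sup>(\<^sup>\<xi>\<^sup>)\<close> has level at least \<open>\<xi> + \<eta>\<close>. The space \<open>Z\<close> is a retract of the Baire space, and determinacy of
  one kind of game yields, for a Borel set \<open>G\<close> and a Borel map \<open>\<theta>\<close> into \<open>Z\<close>, that either some continuous
  map reduces \<open>\<theta>\<^sup>-\<^sup>1 A\<close> to \<open>A\<close> on \<open>G\<close>, or some continuous map into \<open>G\<close> reduces the complement of \<open>A\<close> to
  \<open>\<theta>\<^sup>-\<^sup>1 A\<close>.

  A set \<open>X\<close> in \<open>PU\<^bsub>\<xi> + \<eta>\<^esub>(\<Gamma>\<^sup>(\<^sup>\<xi>\<^sup>))\<close> depends on countably many \<open>\<Sigma>\<^sup>0\<close> sets of class \<open>1 + \<xi>\<close>. A point is coded by an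
  enumeration of those of these sets that contain it, \<open>G\<close> is the set of codes that look consistent,
  and \<open>X\<close> pulls back to a \<open>PU\<^bsub>\<eta>\<^esub>(\<Gamma>)\<close> combination on \<open>G\<close>. In the first case of the dichotomy \<open>X\<close> is in
  \<open>\<Gamma>\<^sup>(\<^sup>\<xi>\<^sup>)\<close>; in the second, the complement of \<open>A\<close> is in \<open>PU\<^bsub>\<eta>\<^esub>(\<Gamma>) = \<Gamma>\<close>, which is absurd.

  Conversely, if \<open>C\<close> is in \<open>PU\<^bsub>\<eta>\<^esub>(\<Gamma>)\<close> but not in \<open>\<Gamma>\<close>, the complement of \<open>A\<close> reduces to \<open>C\<close>, so the assumption on
  \<open>\<Gamma>\<^sup>(\<^sup>\<xi>\<^sup>)\<close> makes \<open>\<Gamma>\<^sup>(\<^sup>\<xi>\<^sup>)\<close> selfdual. This is refuted by diagonalizing against a universal \<open>\<Sigma>\<^sup>0\<close> set of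
  class \<open>1 + \<xi>\<close>, where the dichotomy totalizes the universal partial map.
\<close>

section \<open>Ordinal arithmetic\<close>

lemma add_less_cancel_left_omega1: "a + b < a + c \<longleftrightarrow> b < c" for a b c :: omega1
proof -
  have mono: "a + x < a + y" if "x < y" for x y :: omega1
    using plus_omega1_bound[of a y] that by auto
  show ?thesis
    using mono[of b c] mono[of c b] by (metis less_asym less_irrefl linorder_less_linear)
qed

lemma add_le_cancel_left_omega1: "a + b \<le> a + c \<longleftrightarrow> b \<le> c" for a b c :: omega1
  by (meson add_less_cancel_left_omega1 linorder_not_le)

lemma add_left_cancel_omega1: "a + b = a + c \<longleftrightarrow> b = c" for a b c :: omega1
  by (metis add_le_cancel_left_omega1 antisym order_refl)

text \<open>If \<open>a + b < b\<close>, strict monotonicity gives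
  \<open>a + (a + b) < a + b\<close>, against the induction hypothesis at
  \<open>a + b\<close>.\<close>

lemma le_add_left_omega1: "b \<le> a + b" for a b :: omega1
proof (induction b rule: less_induct)
  case (less b)
  show ?case
  proof (rule ccontr)
    assume "\<not> b \<le> a + b"
    then have "a + b < b" by simp
    with less.IH[OF this] add_less_cancel_left_omega1[of a "a + b" b] show False by simp
  qed
qed

lemma le_add_right_omega1: "a \<le> a + b" for a b :: omega1
  using plus_omega1_bound by blast

text \<open>The least \<open>d\<close> with \<open>c \<le> a + d\<close> works: minimality puts
  every earlier \<open>a + d'\<close> below \<open>c\<close>, and then
  \<open>plus_omega1_least\<close> yields the other inequality.\<close>

lemma le_imp_add_omega1:
  fixes a c :: omega1
  assumes "a \<le> c"
  obtains d where "c = a + d"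
proof -
  define d where "d = (LEAST d. c \<le> a + d)"
  have 1: "c \<le> a + d"
    unfolding d_def by (rule LeastI, rule le_add_left_omega1)
  have "a + d' < c" if "d' < d" for d'
    using not_less_Least[OF that[unfolded d_def]] by simp
  then have "a + d \<le> c"
    by (intro plus_omega1_least assms)
  with 1 that show ?thesis by force
qed

lemma add_zero_left_omega1: "0 + a = (a :: omega1)"
proof (induction a rule: less_induct)
  case (less a)
  have "0 + a \<le> a"
    by (rule plus_omega1_least) (auto simp: zero_le_omega1 less)
  then show ?case using le_add_left_omega1[of a 0] by simp
qed

section \<open>The Borel hierarchy\<close>

lemma is_Sigma0_subset: "is_Sigma0 Z \<alpha> A \<Longrightarrow> A \<subseteq> topspace Z"
  by (induction rule: is_Sigma0.induct) (auto dest: openin_subset)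

lemma Sigma0_subset: "A \<in> Sigma0 \<alpha> Z \<Longrightarrow> A \<subseteq> topspace Z"
  by (simp add: Sigma0_def is_Sigma0_subset)

lemma is_Sigma0_one_le: "is_Sigma0 Z \<alpha> A \<Longrightarrow> 1 \<le> \<alpha>"
  by (induction rule: is_Sigma0.induct) (auto intro: less_imp_le order.trans)

lemma Sigma0_one_le: "A \<in> Sigma0 \<alpha> Z \<Longrightarrow> 1 \<le> \<alpha>"
  by (auto simp: Sigma0_def dest: is_Sigma0_one_le)

lemma Sigma0_one_iff: "A \<in> Sigma0 1 Z \<longleftrightarrow> openin Z A"
proof
  assume "A \<in> Sigma0 1 Z"
  then have "is_Sigma0 Z 1 A" by (simp add: Sigma0_def)
  then show "openin Z A"
    by cases (meson is_Sigma0_one_le leD)+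
qed (simp add: Sigma0_def is_Sigma0.open_set)

lemma Sigma0_UN_Compl:
  "(\<And>n. \<beta> n < \<alpha>) \<Longrightarrow> (\<And>n. B n \<in> Sigma0 (\<beta> n) Z) \<Longrightarrow> (\<Union>n :: nat. topspace Z - B n) \<in> Sigma0 \<alpha> Z"
  unfolding Sigma0_def mem_Collect_eq by (rule is_Sigma0.union) blast

lemma Sigma0_cases:
  assumes "A \<in> Sigma0 \<alpha> Z"
  obtains "\<alpha> = 1" "openin Z A"
  | \<beta> B where "1 < \<alpha>" "\<And>n. \<beta> n < \<alpha>" "\<And>n. B n \<in> Sigma0 (\<beta> n) Z" "A = (\<Union>n :: nat. topspace Z - B n)"
proof -
  have "is_Sigma0 Z \<alpha> A" using assms by (simp add: Sigma0_def)
  then show thesis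
  proof cases
    case (union \<beta> B)
    then have "1 < \<alpha>" using is_Sigma0_one_le le_less_trans by blast
    with union show thesis by (intro that(2)[of \<beta> B]) (simp_all add: Sigma0_def)
  qed (use that in auto)
qed

lemma Sigma0_Compl: "\<beta> < \<alpha> \<Longrightarrow> B \<in> Sigma0 \<beta> Z \<Longrightarrow> topspace Z - B \<in> Sigma0 \<alpha> Z"
  using Sigma0_UN_Compl[of "\<lambda>_. \<beta>" \<alpha> "\<lambda>_. B"] by simp

text \<open>Preimages commute with relative complements and unions, so the classes add up:
  \<open>1 + \<delta>\<close> becomes \<open>1 + (\<xi> + \<delta>)\<close> at each stage, and left
  addition preserves the strict inequalities.\<close>

lemma Sigma0_vimage:
  assumes f: "f \<in> topspace Z \<rightarrow> topspace Y"
    and meas: "\<And>U. openin Y U \<Longrightarrow> f -` U \<inter> topspace Z \<in> Sigma0 (1 + \<xi>) Z"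
    and A: "A \<in> Sigma0 (1 + \<eta>) Y"
  shows "f -` A \<inter> topspace Z \<in> Sigma0 (1 + (\<xi> + \<eta>)) Z"
proof -
  have "\<forall>\<eta>. \<alpha> = 1 + \<eta> \<longrightarrow> f -` A \<inter> topspace Z \<in> Sigma0 (1 + (\<xi> + \<eta>)) Z"
    if "is_Sigma0 Y \<alpha> A" for \<alpha> A
    using that
  proof (induction rule: is_Sigma0.induct)
    case (open_set U)
    \<comment> \<open>The equation \<open>1 = 1 + \<eta>\<close> forces \<open>\<eta> = 0\<close> by
      left cancellation, which leaves just the measurability assumption.\<close>
    then show ?case
      using add_left_cancel_omega1[of 1 0] by (auto simp: plus_zero_omega1 meas)
  next
    case (union \<beta> \<alpha> B)
    show ?case
    proof (intro allI impI)
      fix \<eta> assume \<alpha>: "\<alpha> = 1 + \<eta>"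
      have "\<exists>\<delta>. \<beta> n = 1 + \<delta>" for n
        using union is_Sigma0_one_le le_imp_add_omega1 by metis
      then obtain \<delta> where \<delta>: "\<And>n. \<beta> n = 1 + \<delta> n" by metis
      have "(\<Union>n. topspace Z - (f -` B n \<inter> topspace Z)) \<in> Sigma0 (1 + (\<xi> + \<eta>)) Z"
        using union \<delta> \<alpha>
        by (intro Sigma0_UN_Compl[where \<beta> = "\<lambda>n. 1 + (\<xi> + \<delta> n)"]) (auto simp: add_less_cancel_left_omega1)
      moreover have "(\<Union>n. topspace Z - (f -` B n \<inter> topspace Z)) = f -` (\<Union>n. topspace Y - B n) \<inter> topspace Z"
        using f by auto
      ultimately show "f -` (\<Union>n. topspace Y - B n) \<inter> topspace Z \<in> Sigma0 (1 + (\<xi> + \<eta>)) Z" by simp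
    qed
  qed
  then show ?thesis using A by (auto simp: Sigma0_def)
qed

lemma continuous_map_vimage_open:
  "continuous_map Z Y f \<Longrightarrow> openin Y U \<Longrightarrow> openin Z (f -` U \<inter> topspace Z)"
  by (drule openin_continuous_map_preimage, assumption) (simp add: vimage_def Int_def conj_commute)

lemma Sigma0_continuous_vimage:
  assumes f: "continuous_map Z Y f" and A: "A \<in> Sigma0 (1 + \<eta>) Y"
  shows "f -` A \<inter> topspace Z \<in> Sigma0 (1 + \<eta>) Z"
proof -
  have "f -` U \<inter> topspace Z \<in> Sigma0 (1 + 0) Z" if "openin Y U" for U
    using continuous_map_vimage_open[OF f that] by (simp add: plus_zero_omega1 Sigma0_one_iff)
  from Sigma0_vimage[OF _ this A] show ?thesis
    using f by (simp add: add_zero_left_omega1 continuous_map_def)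
qed

section \<open>The Borel sets of a topology\<close>

lemma space_borel_of [simp]: "space (borel_of Z) = topspace Z"
  unfolding borel_of_def by (rule space_measure_of) (auto dest: openin_subset)

lemma sets_borel_of: "sets (borel_of Z) = sigma_sets (topspace Z) {U. openin Z U}"
  unfolding borel_of_def by (rule sets_measure_of) (auto dest: openin_subset)

lemma open_in_borel_of: "openin Z U \<Longrightarrow> U \<in> sets (borel_of Z)"
  by (simp add: sets_borel_of sigma_sets.Basic)

lemma sets_borel_of_euclidean: "sets (borel_of euclidean) = sets borel"
  by (simp add: sets_borel_of borel_def)

lemma Sigma0_borel:
  assumes "A \<in> Sigma0 \<alpha> Z"
  shows "A \<in> sets (borel_of Z)"
proof -
  have "is_Sigma0 Z \<alpha> A" using assms by (simp add: Sigma0_def)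
  then show ?thesis
  proof (induction rule: is_Sigma0.induct)
    case (union \<beta> \<alpha> B)
    then show ?case
      using sets.compl_sets[of _ "borel_of Z"] by (intro sets.countable_UN) (auto simp: image_subset_iff)
  qed (rule open_in_borel_of)
qed

lemma measurable_borel_ofI:
  assumes "f \<in> space M \<rightarrow> topspace Z" "\<And>U. openin Z U \<Longrightarrow> f -` U \<inter> space M \<in> sets M"
  shows "f \<in> M \<rightarrow>\<^sub>M borel_of Z"
  unfolding borel_of_def using assms by (intro measurable_measure_of) (auto dest: openin_subset)

lemma continuous_map_measurable_borel_of:
  "continuous_map Y Z f \<Longrightarrow> f \<in> borel_of Y \<rightarrow>\<^sub>M borel_of Z"
  by (intro measurable_borel_ofI)
     (auto simp: continuous_map_def intro!: open_in_borel_of continuous_map_vimage_open)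

section \<open>The Baire space\<close>

definition cyl :: "nat list \<Rightarrow> (nat \<Rightarrow> nat) set"
  where "cyl w = {y. \<forall>i<length w. y i = w ! i}"

lemma cyl_map_upt: "cyl (map y [0..<k]) = {y'. \<forall>i<k. y' i = y i}"
  by (simp add: cyl_def)

lemma open_coordinate_eq: "open {y :: nat \<Rightarrow> nat. y i = m}"
proof -
  have "open ((\<lambda>y :: nat \<Rightarrow> nat. y i) -` {m})"
    by (intro open_vimage open_discrete continuous_on_product_coordinates)
  then show ?thesis by (simp add: vimage_def)
qed

lemma open_cyl: "open (cyl w)"
proof -
  have "cyl w = (\<Inter>i\<in>{..<length w}. {y. y i = w ! i})"
    by (auto simp: cyl_def)
  then show ?thesis
    using open_coordinate_eq by (simp add: open_INT)
qed

lemma open_Baire_iff: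
  "open U \<longleftrightarrow> (\<forall>y\<in>U. \<exists>k. cyl (map y [0..<k]) \<subseteq> U)" for U :: "(nat \<Rightarrow> nat) set"
proof
  assume U: "open U"
  show "\<forall>y\<in>U. \<exists>k. cyl (map y [0..<k]) \<subseteq> U"
  proof
    fix y assume "y \<in> U"
    with U have "\<exists>X. y \<in> (\<Pi>\<^sub>E i\<in>UNIV. X i) \<and> (\<forall>i. openin euclidean (X i)) \<and>
        finite {i. X i \<noteq> topspace (euclidean :: nat topology)} \<and> (\<Pi>\<^sub>E i\<in>UNIV. X i) \<subseteq> U"
      by (intro product_topology_open_contains_basis) (simp_all add: open_fun_def)
    then obtain X where X: "y \<in> (\<Pi>\<^sub>E i\<in>UNIV. X i)" "finite {i. X i \<noteq> UNIV}" "(\<Pi>\<^sub>E i\<in>UNIV. X i) \<subseteq> U"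
      by auto
    \<comment> \<open>Only coordinates below \<open>k\<close> are restricted, so the cylinder of
      length \<open>k\<close> around \<open>y\<close> fits into the box.\<close>
    from X(2) obtain k where k: "{i. X i \<noteq> UNIV} \<subseteq> {..<k}"
      using finite_nat_iff_bounded by blast
    have "cyl (map y [0..<k]) \<subseteq> (\<Pi>\<^sub>E i\<in>UNIV. X i)"
    proof
      fix y' assume y': "y' \<in> cyl (map y [0..<k])"
      have "y' i \<in> X i" for i
      proof (cases "i < k")
        case False
        then have "X i = UNIV" using k by auto
        then show ?thesis by simp
      qed (use y' X(1) in \<open>auto simp: cyl_map_upt PiE_iff\<close>)
      then show "y' \<in> (\<Pi>\<^sub>E i\<in>UNIV. X i)" by auto
    qed
    with X(3) show "\<exists>k. cyl (map y [0..<k]) \<subseteq> U" by blast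
  qed
next
  assume *: "\<forall>y\<in>U. \<exists>k. cyl (map y [0..<k]) \<subseteq> U"
  show "open U"
  proof (subst open_subopen, intro ballI)
    fix y assume "y \<in> U"
    with * obtain k where "cyl (map y [0..<k]) \<subseteq> U" by blast
    then show "\<exists>T. open T \<and> y \<in> T \<and> T \<subseteq> U"
      using open_cyl[of "map y [0..<k]"] by (intro exI[of _ "cyl (map y [0..<k])"]) (simp add: cyl_map_upt)
  qed
qed

lemma open_eq_Union_cyl:
  assumes "open U"
  shows "U = (\<Union>w\<in>{w. cyl w \<subseteq> U}. cyl w)"
proof -
  have "\<exists>w. cyl w \<subseteq> U \<and> y \<in> cyl w" if y: "y \<in> U" for y
  proof -
    obtain k where "cyl (map y [0..<k]) \<subseteq> U"
      using assms y open_Baire_iff by blast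
    moreover have "y \<in> cyl (map y [0..<k])"
      by (simp add: cyl_map_upt)
    ultimately show ?thesis by blast
  qed
  then show ?thesis by blast
qed

lemma continuous_map_Baire_iff:
  "continuous_map Z (euclidean :: (nat \<Rightarrow> nat) topology) f \<longleftrightarrow>
    (\<forall>i m. openin Z {x \<in> topspace Z. f x i = m})"
proof
  assume f: "continuous_map Z euclidean f"
  show "\<forall>i m. openin Z {x \<in> topspace Z. f x i = m}"
    using openin_continuous_map_preimage[OF f, of "{y. y _ = _}"] open_coordinate_eq by simp
next
  assume *: "\<forall>i m. openin Z {x \<in> topspace Z. f x i = m}"
  have "openin Z {x \<in> topspace Z. f x \<in> U}" if "open U" for U
  proof (subst openin_subopen, intro ballI)
    fix x assume x: "x \<in> {x \<in> topspace Z. f x \<in> U}"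
    with that obtain k where k: "cyl (map (f x) [0..<k]) \<subseteq> U"
      unfolding open_Baire_iff by blast
    let ?T = "topspace Z \<inter> (\<Inter>i\<in>{..<k}. {x' \<in> topspace Z. f x' i = f x i})"
    have "openin Z ?T"
    proof (cases "k = 0")
      case False
      then have "openin Z (\<Inter>i\<in>{..<k}. {x' \<in> topspace Z. f x' i = f x i})"
        using * by (intro openin_INT2) auto
      then show ?thesis by blast
    qed simp
    moreover have "x \<in> ?T" using x by simp
    moreover have "?T \<subseteq> {x \<in> topspace Z. f x \<in> U}"
      using k by (auto simp: cyl_map_upt)
    ultimately show "\<exists>T. openin Z T \<and> x \<in> T \<and> T \<subseteq> {x \<in> topspace Z. f x \<in> U}" by blast
  qed
  then show "continuous_map Z euclidean f" by (simp add: continuous_map)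
qed

lemma continuous_map_Baire_BaireI:
  fixes F :: "(nat \<Rightarrow> nat) \<Rightarrow> nat \<Rightarrow> nat"
  assumes "\<And>y n. \<exists>k. \<forall>y'. (\<forall>i<k. y' i = y i) \<longrightarrow> F y' n = F y n"
  shows "continuous_map euclidean euclidean F"
  unfolding continuous_map_Baire_iff
  using assms by (simp add: open_Baire_iff cyl_map_upt subset_eq)

section \<open>Games\<close>

text \<open>The play in which one player follows \<open>\<sigma>\<close>, moving at even positions iff \<open>b\<close>, while the
  opponent plays \<open>y\<close>.\<close>

primrec play_prefix :: "bool \<Rightarrow> (nat list \<Rightarrow> nat) \<Rightarrow> (nat \<Rightarrow> nat) \<Rightarrow> nat \<Rightarrow> nat list"
  where "play_prefix b \<sigma> y 0 = []"
  | "play_prefix b \<sigma> y (Suc n) = play_prefix b \<sigma> y n @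
      [if even n = b then \<sigma> (play_prefix b \<sigma> y n) else y (n div 2)]"

definition play :: "bool \<Rightarrow> (nat list \<Rightarrow> nat) \<Rightarrow> (nat \<Rightarrow> nat) \<Rightarrow> nat \<Rightarrow> nat"
  where "play b \<sigma> y n = last (play_prefix b \<sigma> y (Suc n))"

lemma map_play: "map (play b \<sigma> y) [0..<n] = play_prefix b \<sigma> y n"
  by (induction n) (simp_all add: play_def)

lemma play_rec: "play b \<sigma> y n = (if even n = b then \<sigma> (map (play b \<sigma> y) [0..<n]) else y (n div 2))"
  by (simp add: map_play) (simp add: play_def)

lemma play_prefix_cong:
  "\<forall>i<k. y' i = y i \<Longrightarrow> n \<le> k \<Longrightarrow> play_prefix b \<sigma> y' n = play_prefix b \<sigma> y n"
  by (induction n) auto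

lemma continuous_map_play: "continuous_map euclidean euclidean (\<lambda>y n. play b \<sigma> y (g n))" for g :: "nat \<Rightarrow> nat"
proof (rule continuous_map_Baire_BaireI)
  show "\<exists>k. \<forall>y'. (\<forall>i<k. y' i = y i) \<longrightarrow> play b \<sigma> y' (g n) = play b \<sigma> y (g n)" for y n
    using play_prefix_cong[of "Suc (g n)" _ y "Suc (g n)"] unfolding play_def by (metis order_refl)
qed

text \<open>A winning strategy, answering an arbitrary opponent, is a map from the opponent's
  sequence to the winner's own. It is continuous because each move depends on a finite part of the
  play.\<close>

lemma determined_obtain:
  assumes "determined {z. (\<lambda>n. z (2 * n), \<lambda>n. z (2 * n + 1)) \<in> P}"
  obtains F where "continuous_map euclidean euclidean F" "\<And>y. (F y, y) \<in> P"
    | F where "continuous_map euclidean euclidean F" "\<And>x. (x, F x) \<notin> P"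
proof -
  let ?S = "{z. (\<lambda>n. z (2 * n), \<lambda>n. z (2 * n + 1)) \<in> P}"
  consider \<sigma> where "wins_I \<sigma> ?S" | \<tau> where "wins_II \<tau> ?S"
    using assms unfolding determined_def by blast
  then show thesis
  proof cases
    case 1
    have "(\<lambda>n. play True \<sigma> y (2 * n), y) \<in> P" for y
    proof -
      have "play True \<sigma> y (2 * n) = \<sigma> (map (play True \<sigma> y) [0..<2 * n])" for n
        by (subst play_rec) simp
      then have "play True \<sigma> y \<in> ?S"
        using 1 unfolding wins_I_def by blast
      moreover have "play True \<sigma> y (2 * n + 1) = y n" for n
        by (subst play_rec) simp
      ultimately show ?thesis by simp
    qed
    then show thesis by (rule that(1)[OF continuous_map_play])
  next
    case 2
    have "(x, \<lambda>n. play False \<tau> x (2 * n + 1)) \<notin> P" for x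
    proof -
      have "play False \<tau> x (2 * n + 1) = \<tau> (map (play False \<tau> x) [0..<2 * n + 1])" for n
        by (subst play_rec) simp
      then have "play False \<tau> x \<notin> ?S"
        using 2 unfolding wins_II_def by blast
      moreover have "play False \<tau> x (2 * n) = x n" for n
        by (subst play_rec) simp
      ultimately show ?thesis by simp
    qed
    then show thesis by (rule that(2)[OF continuous_map_play])
  qed
qed

section \<open>The Borel hierarchy of a retract of the Baire space\<close>

text \<open>The retraction \<open>r\<close> is total, so every sequence of natural numbers names a
  point of \<open>Z\<close>, and games about \<open>Z\<close> can be played without illegal
  moves.\<close>

locale Baire_retract =
  fixes Z :: "'a topology" and s :: "'a \<Rightarrow> nat \<Rightarrow> nat" and r :: "(nat \<Rightarrow> nat) \<Rightarrow> 'a"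
  assumes cont_s: "continuous_map Z euclidean s"
    and cont_r: "continuous_map euclidean Z r"
    and r_s: "x \<in> topspace Z \<Longrightarrow> r (s x) = x"
begin

lemma r_in: "r y \<in> topspace Z"
  using cont_r by (simp add: continuous_map_def Pi_iff)

text \<open>The preimages under \<open>s\<close> of the countably many cylinders form a clopen base:
  by \<open>r_s\<close>, a cylinder that \<open>r\<close> maps into \<open>U\<close> pulls back into
  \<open>U\<close>.\<close>

lemma openin_eq_UN_clopen:
  assumes U: "openin Z U"
  shows "\<exists>B. U = (\<Union>n :: nat. B n) \<and> (\<forall>n. openin Z (B n) \<and> openin Z (topspace Z - B n))"
proof -
  define b where "b w = s -` cyl w \<inter> topspace Z" for w
  have b: "openin Z (b w)" for w
    unfolding b_def by (intro continuous_map_vimage_open[OF cont_s]) (simp add: open_cyl)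
  have bC: "openin Z (topspace Z - b w)" for w
  proof (subst openin_subopen, intro ballI)
    fix x assume x: "x \<in> topspace Z - b w"
    \<comment> \<open>Points whose codes share the first \<open>length w\<close> entries lie
      together inside or together outside \<open>b w\<close>.\<close>
    let ?v = "map (s x) [0..<length w]"
    have "b ?v \<subseteq> topspace Z - b w"
    proof
      fix x' assume x': "x' \<in> b ?v"
      then have "s x' \<in> cyl w \<longleftrightarrow> s x \<in> cyl w"
        by (auto simp: b_def cyl_def)
      with x x' show "x' \<in> topspace Z - b w" by (auto simp: b_def)
    qed
    moreover have "x \<in> b ?v" using x by (simp add: b_def cyl_def)
    ultimately show "\<exists>T. openin Z T \<and> x \<in> T \<and> T \<subseteq> topspace Z - b w"
      using b by blast
  qed
  define B where "B n = (if b (from_nat n) \<subseteq> U then b (from_nat n) else {})" for n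
  have "\<exists>n. x \<in> B n" if x: "x \<in> U" for x
  proof -
    have "open (r -` U)"
      using continuous_map_vimage_open[OF cont_r U] by simp
    moreover have xZ: "x \<in> topspace Z" using x U openin_subset by blast
    ultimately obtain k where k: "cyl (map (s x) [0..<k]) \<subseteq> r -` U"
      using x r_s open_Baire_iff by (metis vimage_eq)
    have "b (map (s x) [0..<k]) \<subseteq> U"
      using k r_s by (force simp: b_def)
    moreover have "x \<in> b (map (s x) [0..<k])" using xZ by (simp add: b_def cyl_def)
    ultimately have "x \<in> B (to_nat (map (s x) [0..<k]))" by (simp add: B_def)
    then show ?thesis ..
  qed
  moreover have "B n \<subseteq> U" for n by (simp add: B_def)
  ultimately have "U = (\<Union>n. B n)" by blast
  moreover have "openin Z (B n)" "openin Z (topspace Z - B n)" for n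
    using b bC by (simp_all add: B_def)
  ultimately show ?thesis by blast
qed

section \<open>Closure properties of the \<open>\<Sigma>\<^sup>0\<close> classes\<close>

lemma Sigma0_mono_less:
  assumes A: "A \<in> Sigma0 \<beta> Z" and "\<beta> < \<alpha>"
  shows "A \<in> Sigma0 \<alpha> Z"
  using A
proof (cases rule: Sigma0_cases)
  case 1
  from openin_eq_UN_clopen[OF 1(2)] obtain B where A_eq: "A = (\<Union>n :: nat. B n)"
    and B: "\<And>n. openin Z (B n)" "\<And>n. openin Z (topspace Z - B n)"
    by metis
  \<comment> \<open>Each clopen \<open>B n\<close> is written as the complement of an open set,
    which has class 1 and hence class below \<alpha>.\<close>
  have "(\<Union>n. topspace Z - (topspace Z - B n)) \<in> Sigma0 \<alpha> Z"
    using 1(1) \<open>\<beta> < \<alpha>\<close> B by (intro Sigma0_UN_Compl[of "\<lambda>_. 1"]) (simp_all add: Sigma0_one_iff)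
  moreover have "topspace Z - (topspace Z - B n) = B n" for n
    using openin_subset[OF B(1)[of n]] by blast
  ultimately show ?thesis using A_eq by simp
next
  case (2 \<gamma> B)
  show ?thesis unfolding 2(4)
    using 2(2,3) \<open>\<beta> < \<alpha>\<close> less_trans by (intro Sigma0_UN_Compl[of \<gamma>]) blast+
qed

lemma Sigma0_mono: "A \<in> Sigma0 \<beta> Z \<Longrightarrow> \<beta> \<le> \<alpha> \<Longrightarrow> A \<in> Sigma0 \<alpha> Z"
  using Sigma0_mono_less by (auto simp: le_less)

lemma Sigma0_openin: "openin Z U \<Longrightarrow> 1 \<le> \<alpha> \<Longrightarrow> U \<in> Sigma0 \<alpha> Z"
  using Sigma0_mono Sigma0_one_iff by blast

lemma Sigma0_eq_UN_Compl:
  assumes "A \<in> Sigma0 \<alpha> Z" "1 < \<alpha>"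
  obtains \<beta> B where "\<And>n. \<beta> n < \<alpha>" "\<And>n. B n \<in> Sigma0 (\<beta> n) Z" "A = (\<Union>n :: nat. topspace Z - B n)"
  using assms(1)
proof (cases rule: Sigma0_cases)
  case (2 \<beta> B)
  then show thesis using that[of \<beta> B] by blast
qed (use assms(2) in simp)

lemma UN_prod_decode: "(\<Union>i. case_prod F (prod_decode i)) = (\<Union>n k. F n k)"
proof -
  have "x \<in> (\<Union>i. case_prod F (prod_decode i))" if "x \<in> F n k" for x n k
    using that by (intro UN_I[of "prod_encode (n, k)"]) simp_all
  then show ?thesis by (fastforce simp: case_prod_beta)
qed

lemma Sigma0_UN:
  assumes A: "\<And>n :: nat. A n \<in> Sigma0 \<alpha> Z"
  shows "(\<Union>n. A n) \<in> Sigma0 \<alpha> Z"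
proof (cases "\<alpha> = 1")
  case True
  with A show ?thesis by (auto simp: Sigma0_one_iff)
next
  case False
  with Sigma0_one_le[OF A] have \<alpha>: "1 < \<alpha>" by simp
  have "\<exists>\<beta> B. (\<forall>k. \<beta> k < \<alpha> \<and> B k \<in> Sigma0 (\<beta> k) Z) \<and> A n = (\<Union>k :: nat. topspace Z - B k)" for n
    by (rule Sigma0_eq_UN_Compl[OF A[of n] \<alpha>]) blast
  then obtain \<beta> B where B: "\<And>n k. \<beta> n k < \<alpha> \<and> B n k \<in> Sigma0 (\<beta> n k) Z"
      "\<And>n. A n = (\<Union>k :: nat. topspace Z - B n k)"
    by metis
  have "(\<Union>i. topspace Z - case_prod B (prod_decode i)) \<in> Sigma0 \<alpha> Z"
    using B(1) by (intro Sigma0_UN_Compl[of "\<lambda>i. case_prod \<beta> (prod_decode i)"]) (simp_all add: case_prod_beta)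
  moreover have "(\<Union>i. topspace Z - case_prod B (prod_decode i)) = (\<Union>n. A n)"
    unfolding B(2) using UN_prod_decode[of "\<lambda>n k. topspace Z - B n k"] by (simp add: case_prod_beta del: UN_simps)
  ultimately show ?thesis by simp
qed

lemma Sigma0_countable_UN:
  assumes "countable I" "1 \<le> \<alpha>" "\<And>i. i \<in> I \<Longrightarrow> A i \<in> Sigma0 \<alpha> Z"
  shows "(\<Union>i\<in>I. A i) \<in> Sigma0 \<alpha> Z"
proof (cases "I = {}")
  case True
  then show ?thesis using assms(2) Sigma0_openin by simp
next
  case False
  then have "(\<Union>n. A (from_nat_into I n)) \<in> Sigma0 \<alpha> Z"
    using assms by (intro Sigma0_UN) (simp add: from_nat_into)
  moreover have "(\<Union>n. A (from_nat_into I n)) = (\<Union>i\<in>I. A i)"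
    using range_from_nat_into[OF False assms(1)] by (metis image_image)
  ultimately show ?thesis by simp
qed

lemma Sigma0_Un: "A \<in> Sigma0 \<alpha> Z \<Longrightarrow> B \<in> Sigma0 \<alpha> Z \<Longrightarrow> A \<union> B \<in> Sigma0 \<alpha> Z"
  using Sigma0_countable_UN[of "{A, B}" \<alpha> "\<lambda>x. x"] Sigma0_one_le by auto

text \<open>De Morgan turns the intersection of two complements into the complement of a union; the
  two smaller classes are first raised to their maximum, which is still below \<alpha>.\<close>

lemma Sigma0_Int:
  assumes A: "A \<in> Sigma0 \<alpha> Z" and B: "B \<in> Sigma0 \<alpha> Z"
  shows "A \<inter> B \<in> Sigma0 \<alpha> Z"
proof (cases "\<alpha> = 1")
  case True
  with A B show ?thesis by (auto simp: Sigma0_one_iff)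
next
  case False
  with Sigma0_one_le[OF A] have \<alpha>: "1 < \<alpha>" by simp
  obtain \<beta> A' where A': "\<And>n. \<beta> n < \<alpha>" "\<And>n. A' n \<in> Sigma0 (\<beta> n) Z" "A = (\<Union>n :: nat. topspace Z - A' n)"
    by (rule Sigma0_eq_UN_Compl[OF A \<alpha>]) (rule that)
  obtain \<gamma> B' where B': "\<And>n. \<gamma> n < \<alpha>" "\<And>n. B' n \<in> Sigma0 (\<gamma> n) Z" "B = (\<Union>n :: nat. topspace Z - B' n)"
    by (rule Sigma0_eq_UN_Compl[OF B \<alpha>]) (rule that)
  have "(topspace Z - A' n) \<inter> (topspace Z - B' m) \<in> Sigma0 \<alpha> Z" for n m
  proof -
    have "A' n \<union> B' m \<in> Sigma0 (max (\<beta> n) (\<gamma> m)) Z"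
      using Sigma0_mono[OF A'(2)] Sigma0_mono[OF B'(2)] by (intro Sigma0_Un) simp_all
    then have "topspace Z - (A' n \<union> B' m) \<in> Sigma0 \<alpha> Z"
      by (rule Sigma0_Compl[rotated]) (simp add: A' B')
    moreover have "topspace Z - (A' n \<union> B' m) = (topspace Z - A' n) \<inter> (topspace Z - B' m)" by blast
    ultimately show ?thesis by simp
  qed
  then have "(\<Union>n. \<Union>m. (topspace Z - A' n) \<inter> (topspace Z - B' m)) \<in> Sigma0 \<alpha> Z"
    by (intro Sigma0_UN)
  moreover have "A \<inter> B = (\<Union>n. \<Union>m. (topspace Z - A' n) \<inter> (topspace Z - B' m))"
    unfolding A' B' by blast
  ultimately show ?thesis by (simp only:)
qed

text \<open>A set of class below \<alpha> has class \<alpha>, and so has its complement. Open sets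
  at class 1 are split into clopen ones instead.\<close>

lemma Sigma0_eq_UN_Delta0:
  assumes A: "A \<in> Sigma0 \<alpha> Z"
  shows "\<exists>B. A = (\<Union>n :: nat. B n) \<and> (\<forall>n. B n \<in> Delta0 \<alpha> Z)"
  using A
proof (cases rule: Sigma0_cases)
  case 1
  from openin_eq_UN_clopen[OF 1(2)] obtain B where A_eq: "A = (\<Union>n :: nat. B n)"
    and B: "\<And>n. openin Z (B n)" "\<And>n. openin Z (topspace Z - B n)"
    by metis
  have "B n \<in> Delta0 \<alpha> Z" for n
    using 1 B by (simp add: Delta0_def Sigma0_one_iff)
  with A_eq show ?thesis by blast
next
  case (2 \<beta> B)
  have "topspace Z - B n \<in> Delta0 \<alpha> Z" for n
  proof -
    have "topspace Z - (topspace Z - B n) = B n"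
      using Sigma0_subset[OF 2(3)] by blast
    then show ?thesis
      using Sigma0_Compl[OF 2(2,3)[of n]] Sigma0_mono_less[OF 2(3)[of n] 2(2)[of n]] by (simp add: Delta0_def)
  qed
  with 2(4) show ?thesis by blast
qed

lemma Sigma0_measurable_BaireI:
  fixes c :: "'a \<Rightarrow> nat \<Rightarrow> nat"
  assumes c: "\<And>i m. {x \<in> topspace Z. c x i = m} \<in> Sigma0 \<alpha> Z" and U: "open U"
  shows "c -` U \<inter> topspace Z \<in> Sigma0 \<alpha> Z"
proof -
  have \<alpha>: "1 \<le> \<alpha>" using c Sigma0_one_le by blast
  have fin: "{x \<in> topspace Z. \<forall>i<k. c x i = w ! i} \<in> Sigma0 \<alpha> Z" for k :: nat and w
  proof (induction k)
    case 0
    then show ?case using Sigma0_openin[OF openin_topspace \<alpha>] by simp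
  next
    case (Suc k)
    have "{x \<in> topspace Z. \<forall>i<Suc k. c x i = w ! i} =
        {x \<in> topspace Z. \<forall>i<k. c x i = w ! i} \<inter> {x \<in> topspace Z. c x k = w ! k}"
      by (auto simp: less_Suc_eq)
    then show ?case using Sigma0_Int[OF Suc c] by simp
  qed
  have "(\<Union>w\<in>{w. cyl w \<subseteq> U}. {x \<in> topspace Z. \<forall>i<length w. c x i = w ! i}) \<in> Sigma0 \<alpha> Z"
    using \<alpha> by (intro Sigma0_countable_UN fin) auto
  moreover have "c -` U \<inter> topspace Z = (\<Union>w\<in>{w. cyl w \<subseteq> U}. {x \<in> topspace Z. \<forall>i<length w. c x i = w ! i})"
    by (subst open_eq_Union_cyl[OF U]) (auto simp: cyl_def)
  ultimately show ?thesis by simp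
qed

text \<open>A point \<open>c\<close> of the Baire space is read as an enumeration of the set \<open>{j. \<exists>k. c k = Suc j}\<close>;
  the value \<open>0\<close> enumerates nothing.\<close>

lemma Sigma0_enumeration:
  fixes D :: "nat \<Rightarrow> 'a set"
  assumes D: "\<And>j. D j \<in> Sigma0 \<alpha> Z"
  obtains c :: "'a \<Rightarrow> nat \<Rightarrow> nat"
  where "\<And>U. open U \<Longrightarrow> c -` U \<inter> topspace Z \<in> Sigma0 \<alpha> Z"
    and "\<And>x j. x \<in> topspace Z \<Longrightarrow> (\<exists>k. c x k = Suc j) \<longleftrightarrow> x \<in> D j"
proof -
  have "\<exists>B. D j = (\<Union>k :: nat. B k) \<and> (\<forall>k. B k \<in> Delta0 \<alpha> Z)" for j
    by (rule Sigma0_eq_UN_Delta0[OF D])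
  then obtain B where B: "\<And>j. D j = (\<Union>k :: nat. B j k)" "\<And>j k. B j k \<in> Delta0 \<alpha> Z"
    by metis
  \<comment> \<open>Position \<open>prod_encode (j, k)\<close> announces \<open>j\<close> exactly on
    the piece \<open>B j k\<close>. The pieces are in \<open>Delta0\<close>, so the value
    \<open>Suc j\<close> and the value 0 are both taken on sets of class \<alpha>.\<close>
  define c where "c x i = (if x \<in> case_prod B (prod_decode i) then Suc (fst (prod_decode i)) else 0)" for x i
  have "{x \<in> topspace Z. c x i = m} \<in> Sigma0 \<alpha> Z" for i m
  proof -
    obtain j k where i: "prod_decode i = (j, k)" by fastforce
    have sub: "B j k \<subseteq> topspace Z" and S: "B j k \<in> Sigma0 \<alpha> Z" "topspace Z - B j k \<in> Sigma0 \<alpha> Z"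
      using B(2)[of j k] by (auto simp: Delta0_def dest: Sigma0_subset)
    have "{} \<in> Sigma0 \<alpha> Z"
      using Sigma0_openin[OF openin_empty Sigma0_one_le[OF S(1)]] .
    moreover have "{x \<in> topspace Z. c x i = m} =
        (if m = 0 then topspace Z - B j k else if m = Suc j then B j k else {})"
      using sub by (auto simp: c_def i split: if_splits)
    ultimately show ?thesis using S by simp
  qed
  moreover have "(\<exists>i. c x i = Suc j) \<longleftrightarrow> x \<in> D j" for x j
  proof
    assume "\<exists>i. c x i = Suc j"
    then obtain i where "c x i = Suc j" ..
    then have "x \<in> B j (snd (prod_decode i))" by (auto simp: c_def case_prod_beta split: if_splits)
    then show "x \<in> D j" unfolding B(1) by blast
  next
    assume "x \<in> D j"
    then obtain k where "x \<in> B j k" unfolding B(1) by blast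
    then show "\<exists>i. c x i = Suc j" by (intro exI[of _ "prod_encode (j, k)"]) (simp add: c_def)
  qed
  ultimately show thesis by (intro that[of c] Sigma0_measurable_BaireI)
qed

text \<open>Letting the parameter depend on \<open>x\<close> through clopen conditions stands in for
  a universal set in a product space, and is the form used for diagonalization.\<close>

lemma Sigma0_universal:
  assumes "1 \<le> \<alpha>"
  shows "\<exists>U :: (nat \<Rightarrow> bool) \<Rightarrow> 'a set.
    (\<forall>e. (\<forall>i. openin Z {x \<in> topspace Z. e x i} \<and> openin Z {x \<in> topspace Z. \<not> e x i}) \<longrightarrow>
      {x \<in> topspace Z. x \<in> U (e x)} \<in> Sigma0 \<alpha> Z) \<and>
    (\<forall>A\<in>Sigma0 \<alpha> Z. \<exists>d. U d = A)"
  using assms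
proof (induction \<alpha> rule: less_induct)
  case (less \<alpha>)
  show ?case
  proof (cases "\<alpha> = 1")
    case True
    define b where "b n = s -` cyl (from_nat n) \<inter> topspace Z" for n
    have b: "openin Z (b w)" for w
      unfolding b_def by (intro continuous_map_vimage_open[OF cont_s]) (simp add: open_cyl)
    \<comment> \<open>In the open case the parameter selects which basic open sets are
      united.\<close>
    define U where "U d = (\<Union>n\<in>Collect d. b n)" for d
    have "openin Z {x \<in> topspace Z. x \<in> U (e x)}"
      if "\<forall>i. openin Z {x \<in> topspace Z. e x i} \<and> openin Z {x \<in> topspace Z. \<not> e x i}" for e
    proof -
      have "openin Z (\<Union>n. {x \<in> topspace Z. e x n} \<inter> b n)"
        using that b by blast
      moreover have "(\<Union>n. {x \<in> topspace Z. e x n} \<inter> b n) = {x \<in> topspace Z. x \<in> U (e x)}"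
        by (auto simp: U_def)
      ultimately show ?thesis by simp
    qed
    moreover have "\<exists>d. U d = A" if A: "openin Z A" for A
    proof (intro exI[of _ "\<lambda>n. b n \<subseteq> A"] equalityI subsetI)
      fix x assume x: "x \<in> A"
      have "open (r -` A)"
        using continuous_map_vimage_open[OF cont_r A] by simp
      moreover have xZ: "x \<in> topspace Z" using x A openin_subset by blast
      ultimately obtain k where k: "cyl (map (s x) [0..<k]) \<subseteq> r -` A"
        using x r_s open_Baire_iff by (metis vimage_eq)
      let ?n = "to_nat (map (s x) [0..<k])"
      have "b ?n \<subseteq> A" using k r_s by (force simp: b_def)
      moreover have "x \<in> b ?n" using xZ by (simp add: b_def cyl_def)
      ultimately show "x \<in> U (\<lambda>n. b n \<subseteq> A)" by (auto simp: U_def)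
    qed (auto simp: U_def)
    ultimately show ?thesis
      unfolding True Ball_def Sigma0_one_iff by (intro exI[of _ U]) blast
  next
    case False
    with less.prems have \<alpha>: "1 < \<alpha>" by simp
    let ?I = "{1..<\<alpha>}"
    have "?I \<subseteq> {..<\<alpha>}" "1 \<in> ?I" using \<alpha> by auto
    then have I: "countable ?I" "?I \<noteq> {}"
      using countable_subset[OF _ countable_lessThan_omega1] by blast+
    \<comment> \<open>There are only countably many classes below \<alpha>, so \<beta> can list them
      all, starting from class 1.\<close>
    define \<beta> where "\<beta> = from_nat_into ?I"
    have \<beta>: "1 \<le> \<beta> n" "\<beta> n < \<alpha>" for n
      using from_nat_into[OF I(2), of n] by (auto simp: \<beta>_def)
    have \<beta>_surj: "\<exists>n. \<beta> n = \<gamma>" if "1 \<le> \<gamma>" "\<gamma> < \<alpha>" for \<gamma>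
      using from_nat_into_surj[OF I(1), of \<gamma>] that by (auto simp: \<beta>_def)
    have "\<forall>n. \<exists>U :: (nat \<Rightarrow> bool) \<Rightarrow> 'a set.
      (\<forall>e. (\<forall>i. openin Z {x \<in> topspace Z. e x i} \<and> openin Z {x \<in> topspace Z. \<not> e x i}) \<longrightarrow>
        {x \<in> topspace Z. x \<in> U (e x)} \<in> Sigma0 (\<beta> n) Z) \<and>
      (\<forall>A\<in>Sigma0 (\<beta> n) Z. \<exists>d. U d = A)"
      using less.IH \<beta> by blast
    then obtain U :: "nat \<Rightarrow> (nat \<Rightarrow> bool) \<Rightarrow> 'a set" where "\<forall>n.
      (\<forall>e. (\<forall>i. openin Z {x \<in> topspace Z. e x i} \<and> openin Z {x \<in> topspace Z. \<not> e x i}) \<longrightarrow>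
        {x \<in> topspace Z. x \<in> U n (e x)} \<in> Sigma0 (\<beta> n) Z) \<and>
      (\<forall>A\<in>Sigma0 (\<beta> n) Z. \<exists>d. U n d = A)"
      by (rule choice[THEN exE])
    then have U: "(\<forall>i. openin Z {x \<in> topspace Z. e x i} \<and> openin Z {x \<in> topspace Z. \<not> e x i}) \<Longrightarrow>
        {x \<in> topspace Z. x \<in> U n (e x)} \<in> Sigma0 (\<beta> n) Z"
      and U_surj: "A \<in> Sigma0 (\<beta> n) Z \<Longrightarrow> \<exists>d. U n d = A" for n e A
      by simp_all
    \<comment> \<open>The parameter is cut into rows; row \<open>k\<close> codes a set of class
      \<open>\<beta> (fst (prod_decode k))\<close>, so each listed class is available for infinitely
      many rows.\<close>
    define V where "V d = (\<Union>k. topspace Z - U (fst (prod_decode k)) (\<lambda>i. d (prod_encode (k, i))))" for d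
    have "{x \<in> topspace Z. x \<in> V (e x)} \<in> Sigma0 \<alpha> Z"
      if e: "\<forall>i. openin Z {x \<in> topspace Z. e x i} \<and> openin Z {x \<in> topspace Z. \<not> e x i}" for e
    proof -
      have "(\<Union>k. topspace Z - {x \<in> topspace Z. x \<in> U (fst (prod_decode k)) (\<lambda>i. e x (prod_encode (k, i)))})
          \<in> Sigma0 \<alpha> Z"
        using \<beta> e by (intro Sigma0_UN_Compl[where \<beta> = "\<lambda>k. \<beta> (fst (prod_decode k))"] U) blast+
      moreover have "(\<Union>k. topspace Z - {x \<in> topspace Z. x \<in> U (fst (prod_decode k)) (\<lambda>i. e x (prod_encode (k, i)))})
          = {x \<in> topspace Z. x \<in> V (e x)}"
        by (auto simp: V_def)
      ultimately show ?thesis by simp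
    qed
    moreover have "\<exists>d. V d = A" if A: "A \<in> Sigma0 \<alpha> Z" for A
    proof -
      obtain \<gamma> B where B: "\<And>n. \<gamma> n < \<alpha>" "\<And>n. B n \<in> Sigma0 (\<gamma> n) Z" "A = (\<Union>n :: nat. topspace Z - B n)"
        by (rule Sigma0_eq_UN_Compl[OF A \<alpha>]) (rule that)
      \<comment> \<open>Row \<open>(i, n)\<close> holds \<open>B n\<close> if
        \<open>\<beta> i\<close> is its class, and otherwise the whole space, whose complement adds
        nothing to the union.\<close>
      define C where "C k = (case prod_decode k of (i, n) \<Rightarrow> if \<gamma> n = \<beta> i then B n else topspace Z)" for k
      have "C k \<in> Sigma0 (\<beta> (fst (prod_decode k))) Z" for k
        using B(2) Sigma0_openin[OF openin_topspace] \<beta>(1)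
        by (simp add: C_def case_prod_beta) metis
      then have "\<exists>d. U (fst (prod_decode k)) d = C k" for k using U_surj by blast
      then obtain d where d: "\<And>k. U (fst (prod_decode k)) (d k) = C k" by metis
      have "V (\<lambda>j. case_prod d (prod_decode j)) = (\<Union>k. topspace Z - C k)"
        by (simp add: V_def d)
      also have "\<dots> = A"
      proof
        show "(\<Union>k. topspace Z - C k) \<subseteq> A"
          by (auto simp: B(3) C_def case_prod_beta split: if_splits)
        show "A \<subseteq> (\<Union>k. topspace Z - C k)"
        proof
          fix x assume "x \<in> A"
          then obtain n where n: "x \<in> topspace Z" "x \<notin> B n" using B(3) by blast
          obtain i where "\<beta> i = \<gamma> n"
            using \<beta>_surj[OF Sigma0_one_le[OF B(2)] B(1)] by blast
          with n have "x \<in> topspace Z - C (prod_encode (i, n))" by (simp add: C_def)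
          then show "x \<in> (\<Union>k. topspace Z - C k)" by blast
        qed
      qed
      finally show ?thesis by blast
    qed
    ultimately show ?thesis by (intro exI[of _ V]) blast
  qed
qed

end

interpretation Baire: Baire_retract "euclidean :: (nat \<Rightarrow> nat) topology" "\<lambda>x. x" "\<lambda>x. x"
  by unfold_locales auto

section \<open>\<open>\<Sigma>\<^sup>0\<close> sets as operations on countable families\<close>

context Baire_retract
begin

text \<open>\<open>coded_over \<D> \<eta> A\<close> says that \<open>A\<close> arises from the members of \<open>\<D>\<close> by a \<open>\<Sigma>\<^sup>0\<close> operation of
  class \<open>1 + \<eta>\<close>; the operation is described by its effect \<open>P\<close> on arbitrary open subsets \<open>T D\<close> of the
  Baire space substituted for the members of \<open>\<D>\<close>.\<close>

definition coded_over :: "'a set set \<Rightarrow> omega1 \<Rightarrow> 'a set \<Rightarrow> bool"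
  where "coded_over \<D> \<eta> A \<longleftrightarrow>
    (\<forall>T. (\<forall>D. open (T D)) \<longrightarrow> (\<exists>P\<in>Sigma0 (1 + \<eta>) (euclidean :: (nat \<Rightarrow> nat) topology).
      \<forall>x\<in>topspace Z. \<forall>c. (\<forall>D\<in>\<D>. x \<in> D \<longleftrightarrow> c \<in> T D) \<longrightarrow> (x \<in> A \<longleftrightarrow> c \<in> P)))"

text \<open>\<open>T B\<close> itself serves as \<open>P\<close>; being open, it belongs to every
  class \<open>1 + \<delta>\<close>.\<close>

lemma coded_over_singleton: "coded_over {B} \<delta> B"
  unfolding coded_over_def
proof (intro allI impI)
  fix T :: "'a set \<Rightarrow> (nat \<Rightarrow> nat) set" assume "\<forall>D. open (T D)"
  then have "T B \<in> Sigma0 (1 + \<delta>) euclidean"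
    by (intro Baire.Sigma0_openin) (simp_all add: le_add_right_omega1)
  then show "\<exists>P\<in>Sigma0 (1 + \<delta>) euclidean.
      \<forall>x\<in>topspace Z. \<forall>c. (\<forall>D\<in>{B}. x \<in> D \<longleftrightarrow> c \<in> T D) \<longrightarrow> (x \<in> B \<longleftrightarrow> c \<in> P)"
    by blast
qed

lemma coded_over_UN_Compl:
  assumes \<delta>: "\<And>n. \<delta> n < \<eta>" and P: "\<And>n. coded_over (\<D> n) (\<delta> n) (B n)"
  shows "coded_over (\<Union>n. \<D> n) \<eta> (\<Union>n :: nat. topspace Z - B n)"
  unfolding coded_over_def
proof (intro allI impI)
  fix T :: "'a set \<Rightarrow> (nat \<Rightarrow> nat) set" assume T: "\<forall>D. open (T D)"
  have "\<forall>n. \<exists>P. P \<in> Sigma0 (1 + \<delta> n) euclidean \<and>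
      (\<forall>x\<in>topspace Z. \<forall>c. (\<forall>D\<in>\<D> n. x \<in> D \<longleftrightarrow> c \<in> T D) \<longrightarrow> (x \<in> B n \<longleftrightarrow> c \<in> P))"
    using P[unfolded coded_over_def Bex_def, THEN spec, THEN mp, OF T] by (rule allI)
  then obtain Q where Q: "\<forall>n. Q n \<in> Sigma0 (1 + \<delta> n) euclidean \<and>
      (\<forall>x\<in>topspace Z. \<forall>c. (\<forall>D\<in>\<D> n. x \<in> D \<longleftrightarrow> c \<in> T D) \<longrightarrow> (x \<in> B n \<longleftrightarrow> c \<in> Q n))"
    by (rule choice[THEN exE])
  have "(\<Union>n. topspace euclidean - Q n) \<in> Sigma0 (1 + \<eta>) euclidean"
    by (rule Sigma0_UN_Compl[where \<beta> = "\<lambda>n. 1 + \<delta> n"])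
       (use Q in \<open>simp_all add: add_less_cancel_left_omega1 \<delta>\<close>)
  moreover have "x \<in> (\<Union>n. topspace Z - B n) \<longleftrightarrow> c \<in> (\<Union>n. topspace euclidean - Q n)"
    if "x \<in> topspace Z" "\<forall>D\<in>(\<Union>n. \<D> n). x \<in> D \<longleftrightarrow> c \<in> T D" for x c
  proof -
    have "x \<in> B n \<longleftrightarrow> c \<in> Q n" for n
      using that by (intro Q[THEN spec, THEN conjunct2, THEN bspec, THEN spec, THEN mp]) blast+
    then show ?thesis using that(1) by simp
  qed
  ultimately show "\<exists>P\<in>Sigma0 (1 + \<eta>) euclidean. \<forall>x\<in>topspace Z. \<forall>c.
      (\<forall>D\<in>(\<Union>n. \<D> n). x \<in> D \<longleftrightarrow> c \<in> T D) \<longrightarrow> (x \<in> (\<Union>n. topspace Z - B n) \<longleftrightarrow> c \<in> P)"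
    by (intro bexI[of _ "\<Union>n. topspace euclidean - Q n"] ballI allI impI)
qed

text \<open>Induction on \<eta>: each set entering the union either has class at most
  \<open>1 + \<xi>\<close> and becomes a generator, or has class
  \<open>1 + (\<xi> + \<delta>)\<close> with \<open>\<delta> < \<eta>\<close> and is decomposed by
  the induction hypothesis.\<close>

lemma Sigma0_add_coded_over:
  assumes "A \<in> Sigma0 (1 + (\<xi> + \<eta>)) Z"
  shows "\<exists>\<D>. countable \<D> \<and> \<D> \<subseteq> Sigma0 (1 + \<xi>) Z \<and> coded_over \<D> \<eta> A"
  using assms
proof (induction \<eta> arbitrary: A rule: less_induct)
  case (less \<eta>)
  have base: "\<exists>\<D>. countable \<D> \<and> \<D> \<subseteq> Sigma0 (1 + \<xi>) Z \<and> coded_over \<D> \<delta> B"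
    if "B \<in> Sigma0 (1 + \<xi>) Z" for B \<delta>
    using that coded_over_singleton by (intro exI[of _ "{B}"]) simp
  show ?case
  proof (cases "\<eta> = 0")
    case True
    with less.prems have "A \<in> Sigma0 (1 + \<xi>) Z" by (simp add: plus_zero_omega1)
    then show ?thesis by (rule base)
  next
    case False
    then have \<eta>: "0 < \<eta>" using zero_le_omega1[of \<eta>] by simp
    have "(1 :: omega1) + 0 < 1 + (\<xi> + \<eta>)"
      using less_le_trans[OF \<eta> le_add_left_omega1[of \<eta> \<xi>]] by (simp only: add_less_cancel_left_omega1)
    then have lt: "1 < 1 + (\<xi> + \<eta>)" by (simp add: plus_zero_omega1)
    obtain \<beta> B where B: "\<And>n. \<beta> n < 1 + (\<xi> + \<eta>)" "\<And>n. B n \<in> Sigma0 (\<beta> n) Z"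
        "A = (\<Union>n :: nat. topspace Z - B n)"
      by (rule Sigma0_eq_UN_Compl[OF less.prems lt]) (rule that)
    have "\<exists>\<delta> \<D>. \<delta> < \<eta> \<and> countable \<D> \<and> \<D> \<subseteq> Sigma0 (1 + \<xi>) Z \<and> coded_over \<D> \<delta> (B n)" for n
    proof (cases "\<beta> n \<le> 1 + \<xi>")
      case True
      with B(2) have "B n \<in> Sigma0 (1 + \<xi>) Z" by (rule Sigma0_mono)
      from base[OF this, of 0] \<eta> show ?thesis by blast
    next
      case False
      obtain \<gamma> where \<gamma>: "\<beta> n = 1 + \<gamma>"
        by (rule le_imp_add_omega1[OF Sigma0_one_le[OF B(2)]])
      with False have "\<xi> \<le> \<gamma>" by (simp add: add_le_cancel_left_omega1)
      then obtain \<delta> where \<delta>: "\<gamma> = \<xi> + \<delta>" by (rule le_imp_add_omega1)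
      with B(1)[of n] \<gamma> have "\<delta> < \<eta>" by (simp add: add_less_cancel_left_omega1)
      moreover have "B n \<in> Sigma0 (1 + (\<xi> + \<delta>)) Z" using B(2)[of n] \<gamma> \<delta> by simp
      ultimately show ?thesis using less.IH by blast
    qed
    then obtain \<delta> \<D> where \<delta>: "\<And>n. \<delta> n < \<eta>"
      and \<D>: "\<And>n. countable (\<D> n)" "\<And>n. \<D> n \<subseteq> Sigma0 (1 + \<xi>) Z"
      and P: "\<And>n. coded_over (\<D> n) (\<delta> n) (B n)"
      by metis
    have "coded_over (\<Union>n. \<D> n) \<eta> A"
      unfolding B(3) using \<delta> P by (rule coded_over_UN_Compl)
    moreover have "countable (\<Union>n. \<D> n)" "(\<Union>n. \<D> n) \<subseteq> Sigma0 (1 + \<xi>) Z"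
      using \<D> by auto
    ultimately show ?thesis by blast
  qed
qed

end

section \<open>Polish spaces as retracts of the Baire space\<close>

text \<open>Countably many small clopen sets cover \<open>Z\<close>; sending a point to the least
  index of a set containing it turns the cover into a partition.\<close>

lemma small_clopen_partition:
  assumes Z: "separable_space Z" "zero_dimensional Z" and "Metric_space M d" "Z = Metric_space.mtopology M d"
    and \<epsilon>: "\<epsilon> > (0 :: real)"
  shows "\<exists>g :: 'a \<Rightarrow> nat. (\<forall>m. openin Z {x \<in> topspace Z. g x = m}) \<and>
    (\<forall>x\<in>topspace Z. \<forall>y\<in>topspace Z. g x = g y \<longrightarrow> d x y < \<epsilon>)"
proof -
  interpret Metric_space M d by fact
  have top: "topspace Z = M" using assms(4) by simp
  obtain C where C: "countable C" "C \<subseteq> M" "Z closure_of C = M"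
    using Z(1) top unfolding separable_space_def by auto
  have "C \<noteq> {}" using Z(2) C(3) top by (auto simp: zero_dimensional_def)
  \<comment> \<open>One clopen set is chosen for each pair of a point \<open>q\<close> of the dense
    set and a radius \<open>1 / Suc k\<close>, which keeps the cover countable.\<close>
  define ok where "ok q k V \<longleftrightarrow> openin Z V \<and> closedin Z V \<and> mball q (1 / real (Suc k)) \<subseteq> V \<and>
      (\<forall>x\<in>V. \<forall>y\<in>V. d x y < \<epsilon>)" for q k V
  define W where "W q k = (if \<exists>V. ok q k V then (SOME V. ok q k V) else {})" for q k
  have W: "openin Z (W q k) \<and> closedin Z (W q k) \<and> (\<forall>x\<in>W q k. \<forall>y\<in>W q k. d x y < \<epsilon>)" for q k
  proof -
    have "W q k = {} \<or> ok q k (W q k)" using someI_ex[of "ok q k"] by (simp add: W_def)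
    then show ?thesis unfolding ok_def by auto
  qed
  have cover: "\<exists>q\<in>C. \<exists>k. x \<in> W q k" if x: "x \<in> M" for x
  proof -
    have "openin Z (mball x (\<epsilon> / 2))" using assms(4) by simp
    moreover have "x \<in> mball x (\<epsilon> / 2)" using x \<epsilon> by simp
    ultimately obtain V where V: "openin Z V" "closedin Z V" "x \<in> V" "V \<subseteq> mball x (\<epsilon> / 2)"
      using Z(2) unfolding zero_dimensional_def by metis
    obtain \<delta> where \<delta>: "\<delta> > 0" "mball x \<delta> \<subseteq> V"
      using V(1,3) unfolding assms(4) openin_mtopology by blast
    \<comment> \<open>Half of \<delta> leaves room for recentring: the ball of this radius around a
      nearby \<open>q\<close> stays in the ball of radius \<delta> around \<open>x\<close>.\<close>
    obtain k where k: "1 / real (Suc k) < \<delta> / 2"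
      using nat_approx_posE[of "\<delta> / 2"] \<delta>(1) by (metis half_gt_zero)
    have pos: "0 < 1 / real (Suc k)" by simp
    have "x \<in> Z closure_of C" using C(3) x by simp
    moreover have "openin Z (mball x (1 / real (Suc k)))" using assms(4) by simp
    moreover have "x \<in> mball x (1 / real (Suc k))" using x pos by simp
    ultimately obtain q where q: "q \<in> C" "q \<in> mball x (1 / real (Suc k))"
      unfolding in_closure_of by blast
    have dxq: "d x q < 1 / real (Suc k)" "q \<in> M" using q by auto
    have "mball q (1 / real (Suc k)) \<subseteq> V"
    proof
      fix y assume "y \<in> mball q (1 / real (Suc k))"
      then have y: "y \<in> M" "d q y < 1 / real (Suc k)" by auto
      have "d x y \<le> d x q + d q y" using x y dxq by (intro triangle)
      then have "y \<in> mball x \<delta>" using x y dxq k by auto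
      with \<delta>(2) show "y \<in> V" by blast
    qed
    moreover have "d y z < \<epsilon>" if "y \<in> V" "z \<in> V" for y z
    proof -
      have yz: "y \<in> M" "z \<in> M" "d x y < \<epsilon> / 2" "d x z < \<epsilon> / 2" using V(4) that by auto
      have "d y z \<le> d y x + d x z" using x yz by (intro triangle)
      then show ?thesis using yz commute[of x y] by simp
    qed
    ultimately have "ok q k V" using V by (simp add: ok_def)
    then have "ok q k (W q k)" unfolding W_def by (auto intro: someI)
    moreover have "x \<in> mball q (1 / real (Suc k))" using dxq x commute[of x q] by simp
    ultimately show ?thesis using q(1) unfolding ok_def by blast
  qed
  define V where "V n = (case prod_decode n of (i, k) \<Rightarrow> W (from_nat_into C i) k)" for n
  have V: "openin Z (V n)" "closedin Z (V n)" "\<And>x y. x \<in> V n \<Longrightarrow> y \<in> V n \<Longrightarrow> d x y < \<epsilon>" for n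
    using W by (auto simp: V_def case_prod_beta)
  have Vcover: "\<exists>n. x \<in> V n" if x: "x \<in> M" for x
  proof -
    obtain q k where q: "q \<in> C" "x \<in> W q k" using cover[OF x] by blast
    obtain i where "from_nat_into C i = q" using from_nat_into_surj[OF C(1) q(1)] by blast
    with q(2) have "x \<in> V (prod_encode (i, k))" by (simp add: V_def)
    then show ?thesis ..
  qed
  define g where "g x = (LEAST n. x \<in> V n)" for x
  have g: "x \<in> V (g x)" if "x \<in> M" for x
    unfolding g_def using Vcover[OF that] by (rule LeastI_ex)
  have "{x \<in> topspace Z. g x = m} = V m - (\<Union>i<m. V i)" for m
  proof (intro equalityI subsetI)
    fix x assume "x \<in> {x \<in> topspace Z. g x = m}"
    then show "x \<in> V m - (\<Union>i<m. V i)"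
      using g[of x] not_less_Least[of _ "\<lambda>n. x \<in> V n", folded g_def] top by auto
  next
    fix x assume x: "x \<in> V m - (\<Union>i<m. V i)"
    then have "g x = m" unfolding g_def by (intro Least_equality) (auto simp: not_le[symmetric])
    with x openin_subset[OF V(1)[of m]] show "x \<in> {x \<in> topspace Z. g x = m}" by auto
  qed
  moreover have "openin Z (V m - (\<Union>i<m. V i))" for m
    using V by (intro openin_diff closedin_Union) auto
  ultimately have "\<forall>m. openin Z {x \<in> topspace Z. g x = m}" by simp
  moreover have "d x y < \<epsilon>" if "x \<in> topspace Z" "y \<in> topspace Z" "g x = g y" for x y
    using V(3)[of x "g x" y] g[of x] g[of y] that top by simp
  ultimately show ?thesis by blast
qed

text \<open>The map \<open>s\<close> records the cells of a point in partitions of shrinking mesh.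
  Completeness makes its range closed, so a sequence outside the range has a longest realised
  initial segment, and \<open>r\<close> may depend on that segment alone.\<close>

lemma polish_Baire_retract:
  assumes "polish Z" "zero_dimensional Z"
  shows "\<exists>s r. Baire_retract Z s r"
proof -
  from assms(1) obtain M d where "Metric_space M d" and complete: "Metric_space.mcomplete M d"
    and Z: "Z = Metric_space.mtopology M d"
    unfolding polish_def completely_metrizable_space_def by blast
  interpret Metric_space M d by fact
  have top: "topspace Z = M" using Z by simp
  have "\<forall>n. \<exists>g :: 'a \<Rightarrow> nat. (\<forall>m. openin Z {x \<in> M. g x = m}) \<and>
      (\<forall>x\<in>M. \<forall>y\<in>M. g x = g y \<longrightarrow> d x y < 1 / real (Suc n))"
    using small_clopen_partition[OF _ assms(2) \<open>Metric_space M d\<close> Z] assms(1) top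
    unfolding polish_def by simp
  then obtain g :: "nat \<Rightarrow> 'a \<Rightarrow> nat" where g: "\<forall>n. (\<forall>m. openin Z {x \<in> M. g n x = m}) \<and>
      (\<forall>x\<in>M. \<forall>y\<in>M. g n x = g n y \<longrightarrow> d x y < 1 / real (Suc n))"
    by (rule choice[THEN exE])
  define s where "s x n = g n x" for x n
  have s_cont: "continuous_map Z euclidean s"
    using g unfolding continuous_map_Baire_iff top s_def by blast
  have s_dist: "d x y < 1 / real (Suc n)" if "x \<in> M" "y \<in> M" "s x n = s y n" for x y n
    using g that unfolding s_def by blast
  define adm where "adm y k \<longleftrightarrow> (\<exists>x\<in>M. \<forall>i<k. s x i = y i)" for y k
  have adm_mono: "adm y k" if "adm y l" "k \<le> l" for y k l
    using that unfolding adm_def by (meson less_le_trans)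
  obtain x0 where x0: "x0 \<in> M" using assms(2) top by (auto simp: zero_dimensional_def)
  then have adm0: "adm y 0" for y by (auto simp: adm_def)
  \<comment> \<open>Points realising longer and longer initial segments of \<open>y\<close> form a
    Cauchy sequence, and its limit lies in all the prescribed clopen cells.\<close>
  have range: "\<exists>x\<in>M. s x = y" if y: "\<forall>k. adm y k" for y
  proof -
    obtain xs where xs: "\<And>k. xs k \<in> M" "\<And>k i. i < k \<Longrightarrow> s (xs k) i = y i"
      using y unfolding adm_def by metis
    have "MCauchy xs"
      unfolding MCauchy_def
    proof (intro conjI allI impI)
      fix \<epsilon> :: real assume "\<epsilon> > 0"
      then obtain n where n: "1 / real (Suc n) < \<epsilon>" using nat_approx_posE by blast
      have "d (xs k) (xs l) < \<epsilon>" if "Suc n \<le> k" "Suc n \<le> l" for k l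
        using s_dist[OF xs(1) xs(1), of k n l] xs(2)[of n k] xs(2)[of n l] that n by simp
      then show "\<exists>N. \<forall>k l. N \<le> k \<longrightarrow> N \<le> l \<longrightarrow> d (xs k) (xs l) < \<epsilon>" by blast
    qed (use xs in auto)
    then obtain x where x: "limitin Z xs x sequentially"
      using complete unfolding mcomplete_def Z by blast
    then have xM: "x \<in> M" using top by (simp add: limitin_def)
    have "s x i = y i" for i
    proof -
      have "openin Z {x' \<in> M. g i x' = g i x}" using g by blast
      with x xM have "\<forall>\<^sub>F k in sequentially. xs k \<in> {x' \<in> M. g i x' = g i x}"
        unfolding limitin_def by blast
      then obtain N where "\<And>k. k \<ge> N \<Longrightarrow> s (xs k) i = s x i"
        unfolding eventually_sequentially s_def by blast
      from this[of "max N (Suc i)"] xs(2)[of i "max N (Suc i)"] show ?thesis by simp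
    qed
    with xM show ?thesis by blast
  qed
  define \<kappa> where "\<kappa> y = (LEAST k. \<not> adm y (Suc k))" for y
  \<comment> \<open>Outside the range the choice is phrased through the list
    \<open>map y [0..<\<kappa> y]\<close>, so that sequences with the same segment receive literally
    the same point.\<close>
  define r where "r y = (if \<exists>x\<in>M. s x = y then SOME x. x \<in> M \<and> s x = y
      else SOME x. x \<in> M \<and> (\<forall>i\<in>{..<\<kappa> y}. s x i = map y [0..<\<kappa> y] ! i))" for y
  have r_range: "r y \<in> M \<and> s (r y) = y" if "\<exists>x\<in>M. s x = y" for y
    using that someI_ex[of "\<lambda>x. x \<in> M \<and> s x = y"] unfolding r_def by auto
  have \<kappa>: "\<not> adm y (Suc (\<kappa> y))" "adm y (\<kappa> y)" if y: "\<not> (\<exists>x\<in>M. s x = y)" for y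
  proof -
    have "\<exists>k. \<not> adm y (Suc k)"
      using range[of y] y adm_mono by (metis le_SucI order_refl)
    then show 1: "\<not> adm y (Suc (\<kappa> y))" unfolding \<kappa>_def by (rule LeastI_ex)
    show "adm y (\<kappa> y)"
      using not_less_Least[of "\<kappa> y - 1" "\<lambda>k. \<not> adm y (Suc k)"] adm0
      by (cases "\<kappa> y") (auto simp: \<kappa>_def)
  qed
  have r_nonrange: "r y \<in> M \<and> (\<forall>i<\<kappa> y. s (r y) i = y i)" if y: "\<not> (\<exists>x\<in>M. s x = y)" for y
  proof -
    have "\<exists>x. x \<in> M \<and> (\<forall>i\<in>{..<\<kappa> y}. s x i = map y [0..<\<kappa> y] ! i)"
      using \<kappa>(2)[OF y] unfolding adm_def by auto
    from someI_ex[OF this] show ?thesis using y unfolding r_def by simp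
  qed
  have rM: "r y \<in> M" for y using r_range r_nonrange by blast
  have agree: "s (r y) i = y i" if "adm y k" "i < k" for y k i
  proof (cases "\<exists>x\<in>M. s x = y")
    case True
    then show ?thesis using r_range by metis
  next
    case False
    have "k \<le> \<kappa> y" using \<kappa>(1)[OF False] adm_mono[OF that(1)] by (meson not_less_eq_eq)
    then show ?thesis using r_nonrange[OF False] that(2) by simp
  qed
  have r_s: "r (s x) = x" if x: "x \<in> M" for x
  proof (rule ccontr)
    assume ne: "r (s x) \<noteq> x"
    have "s (r (s x)) = s x" using r_range x by blast
    then have small: "d (r (s x)) x < 1 / real (Suc n)" for n using s_dist[OF rM x] by metis
    have "d (r (s x)) x > 0" using ne rM x by simp
    then obtain n where "1 / real (Suc n) < d (r (s x)) x" using nat_approx_posE by blast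
    with small[of n] show False by simp
  qed
  have r_cont: "continuous_map euclidean Z r"
    unfolding continuous_map
  proof (intro conjI allI impI)
    fix U assume U: "openin Z U"
    have "open {y. r y \<in> U}"
      unfolding open_Baire_iff
    proof
      fix y assume "y \<in> {y. r y \<in> U}"
      then have yU: "r y \<in> U" by simp
      show "\<exists>k. cyl (map y [0..<k]) \<subseteq> {y. r y \<in> U}"
      proof (cases "\<exists>x\<in>M. s x = y")
        case True
        obtain \<epsilon> where \<epsilon>: "\<epsilon> > 0" "mball (r y) \<epsilon> \<subseteq> U"
          using U yU unfolding Z openin_mtopology by blast
        \<comment> \<open>A shared entry \<open>n\<close> bounds the distance by
          \<open>1 / Suc n\<close>, which gives continuity at a point of the range.\<close>
        obtain n where n: "1 / real (Suc n) < \<epsilon>" using nat_approx_posE \<epsilon>(1) by blast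
        have "r y' \<in> U" if "y' \<in> cyl (map y [0..<Suc n])" for y'
        proof -
          have eq: "y' i = y i" if "i < Suc n" for i
            using \<open>y' \<in> _\<close> that by (simp add: cyl_map_upt del: upt_Suc)
          have "adm y' (Suc n)" unfolding adm_def using True eq by auto
          from agree[OF this, of n] have "s (r y') n = y n" using eq by simp
          then have "s (r y) n = s (r y') n" using r_range[OF True] by simp
          from s_dist[OF rM rM this] have "r y' \<in> mball (r y) \<epsilon>" using rM n by simp
          with \<epsilon>(2) show ?thesis by blast
        qed
        then show ?thesis by (intro exI[of _ "Suc n"]) auto
      next
        case False
        \<comment> \<open>Outside the range \<open>r\<close> is locally constant: the first
          \<open>Suc (\<kappa> y)\<close> entries already show where the segment stops being
          realised.\<close>
        have "r y' = r y" if "y' \<in> cyl (map y [0..<Suc (\<kappa> y)])" for y'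
        proof -
          have eq: "y' i = y i" if "i < Suc (\<kappa> y)" for i
            using \<open>y' \<in> _\<close> that by (simp add: cyl_map_upt del: upt_Suc)
          have adm_eq: "adm y' k \<longleftrightarrow> adm y k" if "k \<le> Suc (\<kappa> y)" for k
            using eq that by (auto simp: adm_def)
          have F: "\<not> (\<exists>x\<in>M. s x = y')"
            using \<kappa>(1)[OF False] adm_eq[of "Suc (\<kappa> y)"] by (auto simp: adm_def)
          have "\<kappa> y' = \<kappa> y"
            unfolding \<kappa>_def[of y']
          proof (rule Least_equality)
            show "\<not> adm y' (Suc (\<kappa> y))" using \<kappa>(1)[OF False] adm_eq by simp
            show "\<kappa> y \<le> k" if "\<not> adm y' (Suc k)" for k
              using that adm_eq[of "Suc k"] not_less_Least[of k "\<lambda>k. \<not> adm y (Suc k)"]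
              unfolding \<kappa>_def[symmetric] by (metis Suc_le_mono nat_le_linear not_less)
          qed
          moreover have "map y' [0..<\<kappa> y] = map y [0..<\<kappa> y]" using eq by simp
          ultimately show ?thesis using F False unfolding r_def by simp
        qed
        with yU show ?thesis by (intro exI[of _ "Suc (\<kappa> y)"]) (auto simp del: upt_Suc)
      qed
    qed
    then show "openin euclidean {y \<in> topspace euclidean. r y \<in> U}" by simp
  qed (use rM top in auto)
  have "Baire_retract Z s r"
    using s_cont r_cont r_s by unfold_locales (simp_all add: top)
  then show ?thesis by blast
qed

section \<open>Mapping an uncountable retract onto the Cantor space\<close>

context Baire_retract
begin

text \<open>The nodes of a Cantor scheme: clopenness makes the branch bits clopen conditions, and
  uncountability allows further splitting.\<close>

definition big :: "'a set \<Rightarrow> bool"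
  where "big C \<longleftrightarrow> openin Z C \<and> openin Z (topspace Z - C) \<and> uncountable C"

lemma openin_coordinate: "openin Z {x \<in> topspace Z. s x n = m}"
  using cont_s continuous_map_Baire_iff by blast

lemma openin_coordinate_ne: "openin Z {x \<in> topspace Z. s x n \<noteq> m}"
proof -
  have "openin Z (\<Union>k\<in>- {m}. {x \<in> topspace Z. s x n = k})"
    using openin_coordinate by blast
  moreover have "(\<Union>k\<in>- {m}. {x \<in> topspace Z. s x n = k}) = {x \<in> topspace Z. s x n \<noteq> m}" by auto
  ultimately show ?thesis by simp
qed

lemma clopen_Int_coordinate:
  assumes "openin Z C" "openin Z (topspace Z - C)"
  shows "openin Z {x \<in> C. s x n = m}" "openin Z (topspace Z - {x \<in> C. s x n = m})"
    "openin Z (C - {x \<in> C. s x n = m})" "openin Z (topspace Z - (C - {x \<in> C. s x n = m}))"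
proof -
  have sub: "C \<subseteq> topspace Z" using assms(1) by (rule openin_subset)
  have eq: "{x \<in> C. s x n = m} = C \<inter> {x \<in> topspace Z. s x n = m}"
    "C - {x \<in> C. s x n = m} = C \<inter> {x \<in> topspace Z. s x n \<noteq> m}"
    "topspace Z - {x \<in> C. s x n = m} = (topspace Z - C) \<union> {x \<in> topspace Z. s x n \<noteq> m}"
    "topspace Z - (C - {x \<in> C. s x n = m}) = (topspace Z - C) \<union> {x \<in> topspace Z. s x n = m}"
    using sub by auto
  show "openin Z {x \<in> C. s x n = m}"
    by (subst eq(1)) (intro openin_Int assms openin_coordinate)
  show "openin Z (topspace Z - {x \<in> C. s x n = m})"
    by (subst eq(3)) (intro openin_Un assms openin_coordinate_ne)
  show "openin Z (C - {x \<in> C. s x n = m})"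
    by (subst eq(2)) (intro openin_Int assms openin_coordinate_ne)
  show "openin Z (topspace Z - (C - {x \<in> C. s x n = m}))"
    by (subst eq(4)) (intro openin_Un assms openin_coordinate)
qed

lemma big_coordinate:
  assumes "big C"
  obtains m where "big {x \<in> C. s x n = m}"
proof -
  have "C = (\<Union>m. {x \<in> C. s x n = m})" by blast
  moreover have "countable (\<Union>m. {x \<in> C. s x n = m})" if "\<forall>m. countable {x \<in> C. s x n = m}"
    using that by (intro countable_UN) auto
  ultimately have "\<not> (\<forall>m. countable {x \<in> C. s x n = m})"
    using assms unfolding big_def by metis
  then obtain m where "uncountable {x \<in> C. s x n = m}" by blast
  with assms clopen_Int_coordinate[of C n m] that[of m] show thesis unfolding big_def by blast
qed

text \<open>If no coordinate split \<open>C\<close> into two uncountable parts, each coordinate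
  would be constant off a countable set. All but countably many points of \<open>C\<close> would
  then share one code, hence be one point.\<close>

lemma big_split:
  assumes C: "big C"
  obtains D where "D \<subseteq> C" "big D" "big (C - D)"
proof -
  have "\<exists>n m. uncountable {x \<in> C. s x n = m} \<and> uncountable (C - {x \<in> C. s x n = m})"
  proof (rule ccontr)
    assume *: "\<not> ?thesis"
    have "\<exists>m. countable (C - {x \<in> C. s x n = m})" for n
      using big_coordinate[OF C, of n] * unfolding big_def by metis
    then obtain m where m: "\<And>n. countable (C - {x \<in> C. s x n = m n})" by metis
    have "C \<subseteq> insert (r m) (\<Union>n. C - {x \<in> C. s x n = m n})"
    proof
      fix x assume x: "x \<in> C"
      then have xZ: "x \<in> topspace Z" using C openin_subset unfolding big_def by blast
      show "x \<in> insert (r m) (\<Union>n. C - {x \<in> C. s x n = m n})"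
      proof (cases "s x = m")
        case True
        then show ?thesis using r_s[OF xZ] by simp
      next
        case False
        then obtain n where "s x n \<noteq> m n" by blast
        with x show ?thesis by blast
      qed
    qed
    moreover have "countable (insert (r m) (\<Union>n. C - {x \<in> C. s x n = m n}))"
      using m by (intro countable_insert countable_UN) auto
    ultimately show False using C countable_subset unfolding big_def by blast
  qed
  then obtain n m where "uncountable {x \<in> C. s x n = m}" "uncountable (C - {x \<in> C. s x n = m})" by blast
  with clopen_Int_coordinate[of C n m] C show thesis
    by (intro that[of "{x \<in> C. s x n = m}"]) (simp_all add: big_def)
qed

text \<open>Freezing coordinate \<open>n\<close> on both halves makes the codes converge along each
  branch.\<close>

lemma big_split_coordinate:
  assumes C: "big C"
  shows "\<exists>h :: bool \<Rightarrow> 'a set. (\<forall>b. big (h b) \<and> h b \<subseteq> C \<and> (\<exists>m. \<forall>x\<in>h b. s x n = m)) \<and> h True \<inter> h False = {}"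
proof -
  obtain D where D: "D \<subseteq> C" "big D" "big (C - D)" by (rule big_split[OF C])
  obtain m1 where m1: "big {x \<in> D. s x n = m1}" by (rule big_coordinate[OF D(2)])
  obtain m2 where m2: "big {x \<in> C - D. s x n = m2}" by (rule big_coordinate[OF D(3)])
  let ?h = "\<lambda>b. if b then {x \<in> D. s x n = m1} else {x \<in> C - D. s x n = m2}"
  have "?h True \<inter> ?h False = {}" by auto
  moreover have "big (?h b) \<and> ?h b \<subseteq> C \<and> (\<exists>m. \<forall>x\<in>?h b. s x n = m)" for b
    using m1 m2 D(1) by (cases b) auto
  ultimately show ?thesis by (intro exI[of _ ?h]) blast
qed

text \<open>\<open>p\<close> reads branch bits off a Cantor scheme of clopen sets; once a point has
  left the scheme, all further bits are False.\<close>

lemma Cantor_surjection: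
  assumes unc: "uncountable (topspace Z)"
  obtains p :: "'a \<Rightarrow> nat \<Rightarrow> bool"
  where "\<And>i. openin Z {x \<in> topspace Z. p x i}" "\<And>i. openin Z {x \<in> topspace Z. \<not> p x i}"
    and "\<And>e. \<exists>x\<in>topspace Z. p x = e"
proof -
  have "\<forall>nC. \<exists>h :: bool \<Rightarrow> 'a set. big (snd nC) \<longrightarrow>
      (\<forall>b. big (h b) \<and> h b \<subseteq> snd nC \<and> (\<exists>m. \<forall>x\<in>h b. s x (fst nC) = m)) \<and> h True \<inter> h False = {}"
    (is "\<forall>nC. \<exists>h. ?P nC h")
  proof
    show "\<exists>h. ?P nC h" for nC
      using big_split_coordinate[of "snd nC" "fst nC"] by (cases "big (snd nC)") simp_all
  qed
  then obtain h' :: "nat \<times> 'a set \<Rightarrow> bool \<Rightarrow> 'a set" where h': "\<forall>nC. big (snd nC) \<longrightarrow>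
      (\<forall>b. big (h' nC b) \<and> h' nC b \<subseteq> snd nC \<and> (\<exists>m. \<forall>x\<in>h' nC b. s x (fst nC) = m)) \<and>
      h' nC True \<inter> h' nC False = {}"
    by (rule choice[THEN exE])
  define h where "h n C = h' (n, C)" for n C
  have h: "big (h n C b)" "h n C b \<subseteq> C" "\<exists>m. \<forall>x\<in>h n C b. s x n = m" "h n C True \<inter> h n C False = {}"
    if "big C" for n C b
    using h'[THEN spec, of "(n, C)"] that by (simp_all add: h_def)
  \<comment> \<open>The newest bit stands at the head of the list, and \<open>length t\<close> tells
    which coordinate is frozen next.\<close>
  define D where "D = rec_list (topspace Z) (\<lambda>b t C. h (length t) C b)"
  have D_Nil: "D [] = topspace Z" and D_Cons: "D (b # t) = h (length t) (D t) b" for b t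
    by (simp_all add: D_def)
  have bigD: "big (D t)" for t
  proof (induction t)
    case Nil
    then show ?case using unc by (simp add: D_Nil big_def)
  qed (simp add: D_Cons h)
  have disj: "D t \<inter> D t' = {}" if "length t = length t'" "t \<noteq> t'" for t t'
    using that
  proof (induction t t' rule: list_induct2)
    case (Cons b t b' t')
    show ?case
    proof (cases "t = t'")
      case True
      with Cons.prems have "b \<noteq> b'" by simp
      with h(4)[OF bigD[of t], of "length t"] True show ?thesis by (cases b; cases b') (auto simp: D_Cons)
    next
      case False
      with Cons have "D t \<inter> D t' = {}" by simp
      moreover have "D (b # t) \<subseteq> D t" "D (b' # t') \<subseteq> D t'"
        unfolding D_Cons by (rule h(2)[OF bigD])+
      ultimately show ?thesis by blast
    qed
  qed simp
  have D_sub: "D t \<subseteq> topspace Z" for t using bigD[of t] openin_subset unfolding big_def by blast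
  define p where "p x n \<longleftrightarrow> (\<exists>t. length t = n \<and> x \<in> D (True # t))" for x n
  have "openin Z {x \<in> topspace Z. p x n}" for n
  proof -
    have "openin Z (\<Union>t\<in>{t. length t = n}. D (True # t))"
      using bigD unfolding big_def by blast
    moreover have "(\<Union>t\<in>{t. length t = n}. D (True # t)) = {x \<in> topspace Z. p x n}"
      using D_sub by (auto simp: p_def)
    ultimately show ?thesis by simp
  qed
  moreover have "openin Z {x \<in> topspace Z. \<not> p x n}" for n
  proof -
    \<comment> \<open>A level has only finitely many nodes, so the failure of the
      \<open>n\<close>-th bit is an open condition too.\<close>
    have "finite {t :: bool list. length t = n}"
      using finite_lists_length_eq[of "UNIV :: bool set" n] by simp
    moreover have "{t :: bool list. length t = n} \<noteq> {}" using Ex_list_of_length by blast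
    moreover have "openin Z (topspace Z - D (True # t))" for t
      using bigD unfolding big_def by blast
    ultimately have "openin Z (\<Inter>t\<in>{t. length t = n}. topspace Z - D (True # t))"
      by (intro openin_INT2) auto
    moreover have "(\<Inter>t\<in>{t. length t = n}. topspace Z - D (True # t)) = {x \<in> topspace Z. \<not> p x n}"
      using \<open>{t :: bool list. length t = n} \<noteq> {}\<close> by (auto simp: p_def)
    ultimately show ?thesis by simp
  qed
  moreover have "\<exists>x\<in>topspace Z. p x = e" for e
  proof -
    define E where "E n = D (rev (map e [0..<n]))" for n
    have E_Suc: "E (Suc n) = h n (E n) (e n)" for n by (simp add: E_def D_Cons)
    have bigE: "big (E n)" for n using bigD by (simp add: E_def)
    have E_anti: "E (n + k) \<subseteq> E n" for n k
    proof (induction k)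
      case (Suc k)
      then show ?case using h(2)[OF bigE, of "n + k"] E_Suc[of "n + k"] by auto
    qed simp
    have "E n \<noteq> {}" for n
      using bigE[of n] by (auto simp: big_def)
    define x where "x n = (SOME z. z \<in> E n)" for n
    have x: "x n \<in> E n" for n
      using \<open>\<And>n. E n \<noteq> {}\<close> by (simp add: x_def some_in_eq)
    have "\<exists>m. \<forall>x\<in>E (Suc n). s x n = m" for n
      unfolding E_Suc using h(3)[OF bigE] .
    then obtain y where y: "\<And>n x. x \<in> E (Suc n) \<Longrightarrow> s x n = y n" by metis
    \<comment> \<open>Points chosen further down the branch have codes agreeing with
      \<open>y\<close> on longer segments; since every node is closed, the limit \<open>r y\<close>
      stays in it.\<close>
    have in_E: "r y \<in> E n" for n
    proof (rule ccontr)
      assume "r y \<notin> E n"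
      moreover have "open (r -` (topspace Z - E n))"
        using continuous_map_vimage_open[OF cont_r, of "topspace Z - E n"] bigE[of n]
        by (simp add: big_def)
      ultimately obtain k where k: "cyl (map y [0..<k]) \<subseteq> r -` (topspace Z - E n)"
        using r_in open_Baire_iff by (metis Diff_iff vimage_eq)
      let ?x = "x (n + k)"
      have "s ?x i = y i" if "i < k" for i
        using y[of ?x i] x[of "n + k"] E_anti[of "Suc i" "n + k - Suc i"] that by auto
      then have "s ?x \<in> cyl (map y [0..<k])" by (simp add: cyl_map_upt)
      with k have "r (s ?x) \<notin> E n" by blast
      moreover have "?x \<in> E n" using x[of "n + k"] E_anti by blast
      moreover have "?x \<in> topspace Z" using calculation(2) D_sub by (auto simp: E_def)
      ultimately show False using r_s by simp
    qed
    have "p (r y) n = e n" for n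
    proof
      show "p (r y) n" if "e n"
        using in_E[of "Suc n"] that by (auto simp: p_def E_def intro!: exI[of _ "rev (map e [0..<n])"])
      show "e n" if pn: "p (r y) n"
      proof (rule ccontr)
        assume "\<not> e n"
        then have "r y \<in> D (False # rev (map e [0..<n]))" using in_E[of "Suc n"] by (simp add: E_def)
        moreover obtain t where "length t = n" "r y \<in> D (True # t)" using pn by (auto simp: p_def)
        ultimately show False using disj[of "True # t" "False # rev (map e [0..<n])"] by auto
      qed
    qed
    then show ?thesis using r_in by blast
  qed
  ultimately show thesis by (rule that)
qed

end

section \<open>A determined family of subsets of the Baire space\<close>

lemma separable_space_euclidean: "separable_space (euclidean :: 'a::second_countable_topology topology)"
proof -
  obtain D :: "'a set" where D: "countable D" "\<And>X. open X \<Longrightarrow> X \<noteq> {} \<Longrightarrow> \<exists>d\<in>D. d \<in> X"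
    using countable_dense_setE by blast
  have "x \<in> euclidean closure_of D" for x
    unfolding in_closure_of using D(2) by fastforce
  then have "euclidean closure_of D = UNIV" by blast
  with D(1) show ?thesis unfolding separable_space_def by auto
qed

lemma baire_space_eq_euclidean: "baire_space = euclidean"
proof -
  have "discrete_topology (UNIV :: nat set) = euclidean"
    by (simp add: topology_eq open_discrete)
  then show ?thesis unfolding baire_space_def by (simp add: euclidean_product_topology)
qed

lemma metrizable_space_Baire: "metrizable_space (euclidean :: (nat \<Rightarrow> nat) topology)"
  unfolding baire_space_eq_euclidean[symmetric] baire_space_def
  by (simp add: metrizable_space_product_topology)

text \<open>The pointclass speaks of topologies on the type of \<open>Z\<close>, so the Baire space
  is transported there along \<open>b\<close>; \<open>\<S>\<close> consists of the sets whose copies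
  lie in the class.\<close>

lemma determined_family:
  fixes \<Sigma> :: "'a topology \<Rightarrow> 'a set set" and b :: "(nat \<Rightarrow> nat) \<Rightarrow> 'a"
  assumes nice: "nice_pointclass \<Sigma>" and Det: "Det (baire_sets \<Sigma>)"
    and Z: "sep_metrizable Z" and A: "A \<in> \<Sigma> Z" and b: "inj b"
  obtains \<S> where "\<And>S. S \<in> \<S> \<Longrightarrow> determined S"
    and "algebra UNIV \<S>" and "sets borel \<subseteq> \<S>"
    and "\<And>\<phi>. \<phi> \<in> borel \<rightarrow>\<^sub>M borel_of Z \<Longrightarrow> \<phi> -` A \<in> \<S>"
proof -
  define W where "W = pullback_topology (range b) (inv b) (euclidean :: (nat \<Rightarrow> nat) topology)"
  have cb: "continuous_map euclidean W b"
    unfolding W_def using b by (intro continuous_map_pullback') (auto simp: comp_def)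
  have ci: "continuous_map W euclidean (inv b)"
    unfolding W_def using continuous_map_pullback[of euclidean euclidean id "range b" "inv b"] by simp
  have tW: "topspace W = range b" by (simp add: W_def topspace_pullback_topology)
  have maps: "homeomorphic_maps euclidean W b (inv b)"
    unfolding homeomorphic_maps_def using cb ci b tW by (auto simp: f_inv_into_f)
  then have hom: "(euclidean :: (nat \<Rightarrow> nat) topology) homeomorphic_space W" unfolding homeomorphic_space_def by blast
  have sepW: "sep_metrizable W"
    unfolding sep_metrizable_def
    using homeomorphic_separable_space[OF hom] homeomorphic_metrizable_space[OF hom]
      separable_space_euclidean[where 'a = "nat \<Rightarrow> nat"]
      metrizable_space_Baire by simp
  interpret W: algebra "topspace W" "\<Sigma> W"
    using nice sepW unfolding nice_pointclass_def by blast
  define \<S> where "\<S> = {S. b ` S \<in> \<Sigma> W}"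
  have vimage_eq: "inv b -` S \<inter> topspace W = b ` S" for S
    using b tW by (auto simp: image_iff)
  show thesis
  proof
    show "determined S" if "S \<in> \<S>" for S
      using Det that homeomorphic_maps_imp_map[OF maps]
      unfolding Det_def baire_sets_def \<S>_def baire_space_eq_euclidean by blast
    show "algebra UNIV \<S>"
      unfolding algebra_iff_Un
    proof (intro conjI ballI)
      show "UNIV - S \<in> \<S>" if "S \<in> \<S>" for S
      proof -
        have "b ` (UNIV - S) = topspace W - b ` S" using b tW by (simp add: image_set_diff)
        then show ?thesis using that W.compl_sets by (simp add: \<S>_def)
      qed
    qed (auto simp: \<S>_def image_Un)
    show "sets borel \<subseteq> \<S>"
    proof
      fix S :: "(nat \<Rightarrow> nat) set" assume "S \<in> sets borel"
      then have "inv b -` S \<inter> topspace W \<in> sets (borel_of W)"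
        using measurable_sets[OF continuous_map_measurable_borel_of[OF ci], of S]
        by (simp add: sets_borel_of_euclidean)
      then show "S \<in> \<S>"
        using nice sepW unfolding nice_pointclass_def vimage_eq \<S>_def by blast
    qed
    fix \<phi> :: "(nat \<Rightarrow> nat) \<Rightarrow> 'a" assume "\<phi> \<in> borel \<rightarrow>\<^sub>M borel_of Z"
    then have "(\<lambda>x. \<phi> (inv b x)) \<in> borel_of W \<rightarrow>\<^sub>M borel_of Z"
      by (rule measurable_compose[rotated])
         (use continuous_map_measurable_borel_of[OF ci] in
           \<open>simp add: measurable_cong_sets[OF refl sets_borel_of_euclidean]\<close>)
    with nice sepW Z A have "(\<lambda>x. \<phi> (inv b x)) -` A \<inter> topspace W \<in> \<Sigma> W"
      unfolding nice_pointclass_def by blast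
    moreover have "(\<lambda>x. \<phi> (inv b x)) -` A \<inter> topspace W = b ` (\<phi> -` A)"
      unfolding vimage_eq[symmetric] by auto
    ultimately show "\<phi> -` A \<in> \<S>" by (simp add: \<S>_def)
  qed
qed

section \<open>Decoding points of the Baire space\<close>

text \<open>\<open>c \<in> T i m\<close> is read as: \<open>c\<close> asserts that the coded
  sequence has entry \<open>m\<close> at index \<open>i\<close>.\<close>

definition decodable :: "(nat \<Rightarrow> nat \<Rightarrow> (nat \<Rightarrow> nat) set) \<Rightarrow> (nat \<Rightarrow> nat) set"
  where "decodable T = {c. \<forall>i. \<exists>!m. c \<in> T i m}"

definition decode :: "(nat \<Rightarrow> nat \<Rightarrow> (nat \<Rightarrow> nat) set) \<Rightarrow> (nat \<Rightarrow> nat) \<Rightarrow> nat \<Rightarrow> nat"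
  where "decode T c i = (LEAST m. c \<in> T i m)"

lemma decode_eq_iff:
  assumes "c \<in> decodable T"
  shows "decode T c i = m \<longleftrightarrow> c \<in> T i m"
proof -
  have ex1: "\<exists>!m. c \<in> T i m" using assms by (simp add: decodable_def)
  then have "c \<in> T i (decode T c i)" unfolding decode_def by (metis LeastI)
  with ex1 show ?thesis by blast
qed

lemma decode_eqI:
  assumes "\<And>i m. c \<in> T i m \<longleftrightarrow> y i = m"
  shows "c \<in> decodable T" "decode T c = y"
proof -
  show c: "c \<in> decodable T" using assms by (auto simp: decodable_def)
  show "decode T c = y" using decode_eq_iff[OF c] assms by blast
qed

lemma continuous_map_decode:
  assumes F: "continuous_map Y euclidean F" and T: "\<And>i m. open (T i m)"
    and dec: "\<And>y. y \<in> topspace Y \<Longrightarrow> F y \<in> decodable T"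
  shows "continuous_map Y euclidean (\<lambda>y. decode T (F y))"
  unfolding continuous_map_Baire_iff
proof (intro allI)
  fix i m
  have "openin Y (F -` T i m \<inter> topspace Y)"
    using T by (intro continuous_map_vimage_open[OF F]) simp
  moreover have "F -` T i m \<inter> topspace Y = {y \<in> topspace Y. decode T (F y) i = m}"
    using dec decode_eq_iff by blast
  ultimately show "openin Y {y \<in> topspace Y. decode T (F y) i = m}" by simp
qed

lemma borel_decodable:
  assumes T: "\<And>i m. open (T i m)"
  shows "decodable T \<in> sets borel"
proof -
  have [measurable]: "T i m \<in> sets borel" for i m using T by simp
  have "{c \<in> space borel. \<forall>i. \<exists>m. c \<in> T i m \<and> (\<forall>m'. c \<in> T i m' \<longrightarrow> m' = m)} \<in> sets borel"
    by measurable
  moreover have "{c \<in> space borel. \<forall>i. \<exists>m. c \<in> T i m \<and> (\<forall>m'. c \<in> T i m' \<longrightarrow> m' = m)} = decodable T"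
    by (simp add: decodable_def Ex1_def)
  ultimately show ?thesis by (simp only:)
qed

lemma measurable_decode:
  assumes T: "\<And>i m. open (T i m)"
  shows "decode T \<in> borel \<rightarrow>\<^sub>M borel"
proof (rule measurable_coordinatewise_then_product)
  fix i
  have [measurable]: "T i m \<in> sets borel" for i m using T by simp
  have "(\<lambda>c. decode T c i) \<in> borel \<rightarrow>\<^sub>M count_space UNIV"
    unfolding decode_def by measurable
  then show "(\<lambda>c. decode T c i) \<in> borel_measurable borel"
    by (rule measurable_compose) simp
qed

section \<open>A Wadge dichotomy\<close>

text \<open>Niceness and determinacy enter the games through the algebra \<open>\<S>\<close>, which
  contains all payoff sets built from Borel sets and Borel preimages of \<open>A\<close>.\<close>

locale determined_retract = Baire_retract Z s r for Z :: "'a topology" and s r +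
  fixes A :: "'a set" and \<S> :: "(nat \<Rightarrow> nat) set set"
  assumes A_sub: "A \<subseteq> topspace Z"
    and det: "\<And>S. S \<in> \<S> \<Longrightarrow> determined S"
    and algebra: "algebra UNIV \<S>"
    and borel_sub: "sets borel \<subseteq> \<S>"
    and vimage_A: "\<And>\<phi>. \<phi> \<in> borel \<rightarrow>\<^sub>M borel_of Z \<Longrightarrow> \<phi> -` A \<in> \<S>"
begin

interpretation \<S>: algebra UNIV \<S> by (rule algebra)

lemma measurable_r: "r \<in> borel \<rightarrow>\<^sub>M borel_of Z"
  using continuous_map_measurable_borel_of[OF cont_r]
  by (simp add: measurable_cong_sets[OF sets_borel_of_euclidean refl])

lemma continuous_imp_borel: "continuous_map euclidean Z f \<Longrightarrow> f \<in> borel \<rightarrow>\<^sub>M borel_of Z"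
  using continuous_map_measurable_borel_of[of euclidean Z f]
  by (simp add: measurable_cong_sets[OF sets_borel_of_euclidean refl])

lemma measurable_subsequence: "(\<lambda>z n. z (g n :: nat)) \<in> (borel :: (nat \<Rightarrow> nat) measure) \<rightarrow>\<^sub>M borel"
  for g :: "nat \<Rightarrow> nat"
  by (rule measurable_coordinatewise_then_product)
     (intro borel_measurable_continuous_onI continuous_on_product_coordinates)

text \<open>Player I plays \<open>c\<close> and player II plays \<open>y\<close>; player I wins if \<open>c \<in> G\<close> and \<open>\<theta> c \<in> A \<longleftrightarrow> r y \<notin> A\<close>.\<close>

lemma reduction_dichotomy:
  fixes G :: "(nat \<Rightarrow> nat) set"
  assumes G: "G \<in> sets borel" and \<theta>: "\<theta> \<in> borel \<rightarrow>\<^sub>M borel_of Z"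
  obtains F where "continuous_map euclidean euclidean F" "\<And>c. c \<in> G \<Longrightarrow> \<theta> c \<in> A \<longleftrightarrow> r (F c) \<in> A"
    | F where "continuous_map euclidean euclidean F" "\<And>y. F y \<in> G" "\<And>y. \<theta> (F y) \<in> A \<longleftrightarrow> r y \<notin> A"
proof -
  define P where "P = {(c, y). c \<in> G \<and> (\<theta> c \<in> A \<longleftrightarrow> r y \<notin> A)}"
  let ?ev = "\<lambda>(z :: nat \<Rightarrow> nat) n. z (2 * n)" and ?od = "\<lambda>(z :: nat \<Rightarrow> nat) n. z (2 * n + 1)"
  have "?ev -` G \<in> \<S>"
    using measurable_sets[OF measurable_subsequence G] borel_sub by auto
  moreover have "(\<lambda>z. \<theta> (?ev z)) -` A \<in> \<S>"
    by (intro vimage_A measurable_compose[OF measurable_subsequence \<theta>])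
  moreover have "(\<lambda>z. r (?od z)) -` A \<in> \<S>"
    by (intro vimage_A measurable_compose[OF measurable_subsequence measurable_r])
  ultimately have "?ev -` G \<inter> (((\<lambda>z. \<theta> (?ev z)) -` A - (\<lambda>z. r (?od z)) -` A) \<union>
      ((\<lambda>z. r (?od z)) -` A - (\<lambda>z. \<theta> (?ev z)) -` A)) \<in> \<S>"
    by (intro \<S>.Int \<S>.Un \<S>.Diff)
  moreover have "?ev -` G \<inter> (((\<lambda>z. \<theta> (?ev z)) -` A - (\<lambda>z. r (?od z)) -` A) \<union>
      ((\<lambda>z. r (?od z)) -` A - (\<lambda>z. \<theta> (?ev z)) -` A)) = {z. (?ev z, ?od z) \<in> P}"
    by (auto simp: P_def)
  ultimately have "determined {z. (?ev z, ?od z) \<in> P}" using det by simp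
  then show thesis
  proof (cases rule: determined_obtain)
    case (1 F)
    then show thesis by (intro that(2)[of F]) (auto simp: P_def)
  next
    case (2 F)
    then show thesis by (intro that(1)[of F]) (auto simp: P_def)
  qed
qed

section \<open>The level of an expansion\<close>

definition lower :: "'a set set"
  where "lower = {f -` A \<inter> topspace Z | f. continuous_map Z Z f}"

lemma Sigma0_measurable_vimage:
  "Sigma0_measurable \<alpha> Z f \<Longrightarrow> openin Z U \<Longrightarrow> f -` U \<inter> topspace Z \<in> Sigma0 \<alpha> Z"
  unfolding Sigma0_measurable_def by blast

lemma Sigma0_measurable_in: "Sigma0_measurable \<alpha> Z f \<Longrightarrow> x \<in> topspace Z \<Longrightarrow> f x \<in> topspace Z"
  unfolding Sigma0_measurable_def by blast

text \<open>Following a measurable map by a continuous one gives a measurable map of the same class,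
  so \<open>A\<close> alone generates the expansion.\<close>

lemma expansion_lower:
  "expansion Z \<xi> lower = {f -` A \<inter> topspace Z | f. Sigma0_measurable (1 + \<xi>) Z f}"
proof (intro equalityI subsetI)
  fix X assume "X \<in> expansion Z \<xi> lower"
  then obtain f g where g: "continuous_map Z Z g" and f: "Sigma0_measurable (1 + \<xi>) Z f"
    and X: "X = f -` (g -` A \<inter> topspace Z) \<inter> topspace Z"
    unfolding expansion_def lower_def by blast
  have f_in: "f \<in> topspace Z \<rightarrow> topspace Z" using f by (simp add: Sigma0_measurable_def)
  have "Sigma0_measurable (1 + \<xi>) Z (\<lambda>x. g (f x))"
    unfolding Sigma0_measurable_def
  proof (intro conjI allI impI)
    show "(\<lambda>x. g (f x)) \<in> topspace Z \<rightarrow> topspace Z"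
      using f_in g by (auto simp: continuous_map_def Pi_iff)
    fix U assume "openin Z U"
    then have "f -` (g -` U \<inter> topspace Z) \<inter> topspace Z \<in> Sigma0 (1 + \<xi>) Z"
      by (intro Sigma0_measurable_vimage[OF f] continuous_map_vimage_open[OF g])
    moreover have "f -` (g -` U \<inter> topspace Z) \<inter> topspace Z = (\<lambda>x. g (f x)) -` U \<inter> topspace Z"
      using f_in by auto
    ultimately show "(\<lambda>x. g (f x)) -` U \<inter> topspace Z \<in> Sigma0 (1 + \<xi>) Z" by simp
  qed
  moreover have "X = (\<lambda>x. g (f x)) -` A \<inter> topspace Z" using f_in X by auto
  ultimately show "X \<in> {f -` A \<inter> topspace Z | f. Sigma0_measurable (1 + \<xi>) Z f}" by blast
next
  fix X assume "X \<in> {f -` A \<inter> topspace Z | f. Sigma0_measurable (1 + \<xi>) Z f}"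
  moreover have "(\<lambda>x. x) -` A \<inter> topspace Z \<in> lower"
    unfolding lower_def by (intro CollectI exI[of _ "\<lambda>x. x"]) simp
  then have "A \<in> lower" using A_sub by (simp add: Int_absorb2)
  ultimately show "X \<in> expansion Z \<xi> lower" unfolding expansion_def by blast
qed

lemma Sigma0_measurable_compose_Baire:
  assumes c: "\<And>U. open U \<Longrightarrow> c -` U \<inter> topspace Z \<in> Sigma0 \<alpha> Z"
    and f: "continuous_map euclidean Z f"
  shows "Sigma0_measurable \<alpha> Z (\<lambda>x. f (c x))"
  unfolding Sigma0_measurable_def
proof (intro conjI allI impI)
  show "(\<lambda>x. f (c x)) \<in> topspace Z \<rightarrow> topspace Z"
    using f by (auto simp: continuous_map_def)
  fix U assume "openin Z U"
  then have "open (f -` U)" using continuous_map_vimage_open[OF f] by simp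
  from c[OF this] show "(\<lambda>x. f (c x)) -` U \<inter> topspace Z \<in> Sigma0 \<alpha> Z"
    by (simp add: vimage_def)
qed

lemma compose_r: "continuous_map euclidean euclidean F \<Longrightarrow> continuous_map euclidean Z (\<lambda>y. r (F y))"
  by (drule continuous_map_compose[OF _ cont_r]) (simp only: comp_def)

lemma compose_r_s: "continuous_map euclidean euclidean F \<Longrightarrow> continuous_map Z Z (\<lambda>x. r (F (s x)))"
  by (drule continuous_map_compose[OF cont_s compose_r]) (simp only: comp_def)

lemma Sigma0_coordinate:
  assumes "Sigma0_measurable \<alpha> Z f"
  shows "{x \<in> topspace Z. s (f x) i = m} \<in> Sigma0 \<alpha> Z"
proof -
  have "f -` {x \<in> topspace Z. s x i = m} \<inter> topspace Z \<in> Sigma0 \<alpha> Z"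
    by (rule Sigma0_measurable_vimage[OF assms openin_coordinate])
  moreover have "f -` {x \<in> topspace Z. s x i = m} \<inter> topspace Z = {x \<in> topspace Z. s (f x) i = m}"
    using Sigma0_measurable_in[OF assms] by auto
  ultimately show ?thesis by simp
qed

lemma PU_memI:
  "(\<And>n :: nat. B n \<in> \<Gamma>) \<Longrightarrow> (\<And>n. V n \<in> Delta0 (1 + \<xi>) Z) \<Longrightarrow> disjoint_family V \<Longrightarrow>
    (\<Union>n. V n) = topspace Z \<Longrightarrow> (\<Union>n. B n \<inter> V n) \<in> PU Z \<xi> \<Gamma>"
  unfolding PU_def by blast

lemma open_enumerates: "open {c :: nat \<Rightarrow> nat. \<exists>j k. Q j \<and> c k = Suc j}"
proof -
  have "{c :: nat \<Rightarrow> nat. \<exists>j k. Q j \<and> c k = Suc j} = (\<Union>j\<in>Collect Q. \<Union>k. {c. c k = Suc j})" by auto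
  moreover have "open (\<Union>j\<in>Collect Q. \<Union>k. {c :: nat \<Rightarrow> nat. c k = Suc j})"
    by (intro open_UN ballI open_coordinate_eq)
  ultimately show ?thesis by (simp only:)
qed

text \<open>A non-selfdual class has a non-selfdual expansion.  Diagonalization: the map \<open>u\<close> follows the
  partial map read off from a universal sequence of \<open>\<Sigma>\<^sup>0\<close> sets, made total by the dichotomy.\<close>

lemma expansion_diagonal:
  assumes unc: "uncountable (topspace Z)" and nsd: "topspace Z - A \<notin> lower"
  obtains u where "Sigma0_measurable (1 + \<xi>) Z u"
    and "\<And>v. Sigma0_measurable (1 + \<xi>) Z v \<Longrightarrow> u -` (topspace Z - A) \<inter> topspace Z \<noteq> v -` A \<inter> topspace Z"
proof -
  obtain p :: "'a \<Rightarrow> nat \<Rightarrow> bool" where p: "\<And>i. openin Z {x \<in> topspace Z. p x i}"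
      "\<And>i. openin Z {x \<in> topspace Z. \<not> p x i}" and p_surj: "\<And>e. \<exists>x\<in>topspace Z. p x = e"
    by (rule Cantor_surjection[OF unc]) (rule that)
  obtain U :: "(nat \<Rightarrow> bool) \<Rightarrow> 'a set" where
    U: "\<And>e. \<forall>i. openin Z {x \<in> topspace Z. e x i} \<and> openin Z {x \<in> topspace Z. \<not> e x i} \<Longrightarrow>
        {x \<in> topspace Z. x \<in> U (e x)} \<in> Sigma0 (1 + \<xi>) Z"
    and U_surj: "\<And>B. B \<in> Sigma0 (1 + \<xi>) Z \<Longrightarrow> \<exists>d. U d = B"
    using Sigma0_universal[OF le_add_right_omega1[of 1 \<xi>]] by (elim exE conjE) blast
  \<comment> \<open>Row \<open>j\<close> of \<open>p x\<close> serves as parameter, so at a suitable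
    \<open>x\<close> membership in all the \<open>D j\<close> copies membership in any prescribed
    list of sets of the class.\<close>
  define D where "D j = {x \<in> topspace Z. x \<in> U (\<lambda>k. p x (prod_encode (j, k)))}" for j
  have "D j \<in> Sigma0 (1 + \<xi>) Z" for j
    unfolding D_def by (rule U) (simp add: p)
  then obtain c :: "'a \<Rightarrow> nat \<Rightarrow> nat"
    where c: "\<And>U. open U \<Longrightarrow> c -` U \<inter> topspace Z \<in> Sigma0 (1 + \<xi>) Z"
      and c_D: "\<And>x j. x \<in> topspace Z \<Longrightarrow> (\<exists>k. c x k = Suc j) \<longleftrightarrow> x \<in> D j"
    by (rule Sigma0_enumeration) (rule that)
  define T where "T i m = {c :: nat \<Rightarrow> nat. \<exists>j k. j = prod_encode (i, m) \<and> c k = Suc j}" for i m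
  have T: "open (T i m)" for i m unfolding T_def by (rule open_enumerates)
  have meas: "(\<lambda>c. r (decode T c)) \<in> borel \<rightarrow>\<^sub>M borel_of Z"
    by (rule measurable_compose[OF measurable_decode[of T, OF T] measurable_r])
  have "\<exists>F. continuous_map euclidean euclidean F \<and>
      (\<forall>y\<in>decodable T. r (decode T y) \<in> A \<longleftrightarrow> r (F y) \<in> A)"
  proof (cases rule: reduction_dichotomy[OF borel_decodable[of T, OF T] meas])
    case (1 F)
    then show ?thesis by blast
  next
    case (2 F)
    \<comment> \<open>A continuous map into the decodable points would decode to a continuous
      reduction of the complement of \<open>A\<close> to \<open>A\<close>, which \<open>nsd\<close>
      excludes.\<close>
    have "continuous_map euclidean euclidean (\<lambda>y. decode T (F y))"
      using 2 T by (intro continuous_map_decode) auto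
    then have "(\<lambda>x. r (decode T (F (s x)))) -` A \<inter> topspace Z \<in> lower"
      unfolding lower_def using compose_r_s by blast
    moreover have "(\<lambda>x. r (decode T (F (s x)))) -` A \<inter> topspace Z = topspace Z - A"
      using 2(3) r_s by auto
    ultimately show ?thesis using nsd by simp
  qed
  then obtain F where F: "continuous_map euclidean euclidean F"
    and F_red: "\<And>y. y \<in> decodable T \<Longrightarrow> r (decode T y) \<in> A \<longleftrightarrow> r (F y) \<in> A"
    by blast
  define u where "u x = r (F (c x))" for x
  have u: "Sigma0_measurable (1 + \<xi>) Z u"
    unfolding u_def by (rule Sigma0_measurable_compose_Baire[OF c compose_r[OF F]])
  moreover have "u -` (topspace Z - A) \<inter> topspace Z \<noteq> v -` A \<inter> topspace Z"
    if v: "Sigma0_measurable (1 + \<xi>) Z v" for v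
  proof
    assume eq: "u -` (topspace Z - A) \<inter> topspace Z = v -` A \<inter> topspace Z"
    have "\<exists>d. U d = {x \<in> topspace Z. s (v x) (fst (prod_decode j)) = snd (prod_decode j)}" for j
      by (rule U_surj[OF Sigma0_coordinate[OF v]])
    then obtain d where d: "\<And>j. U (d j) = {x \<in> topspace Z. s (v x) (fst (prod_decode j)) = snd (prod_decode j)}"
      by metis
    \<comment> \<open>The diagonal point: its parameters describe the graph of
      \<open>s (v x)\<close>, so \<open>c x\<close> decodes to \<open>s (v x)\<close>. Hence
      \<open>u x\<close> and \<open>v x\<close> agree about \<open>A\<close>, whereas
      \<open>eq\<close> makes them disagree.\<close>
    obtain x where x: "x \<in> topspace Z" and px: "p x = (\<lambda>l. case_prod d (prod_decode l))"
      using p_surj by blast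
    have "x \<in> D (prod_encode (i, m)) \<longleftrightarrow> s (v x) i = m" for i m
      using x by (simp add: D_def px d)
    then have cT: "c x \<in> T i m \<longleftrightarrow> s (v x) i = m" for i m
      using c_D[OF x, of "prod_encode (i, m)"] by (simp add: T_def)
    have "c x \<in> decodable T" "decode T (c x) = s (v x)"
      using decode_eqI[of "c x" T "s (v x)"] cT by auto
    moreover have "v x \<in> topspace Z" using v x by (auto simp: Sigma0_measurable_def)
    ultimately have "v x \<in> A \<longleftrightarrow> u x \<in> A"
      using F_red[of "c x"] r_s by (simp add: u_def)
    moreover have "u x \<in> topspace Z" by (simp add: u_def r_in)
    ultimately show False using eq x by blast
  qed
  ultimately show thesis by (rule that)
qed

text \<open>Coding by sets of class \<open>1 + \<xi>\<close> strips \<xi> from the complexity: over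
  the codes, the pieces have class \<open>1 + \<eta>\<close> and each \<open>f n\<close> becomes a
  continuous decoding.\<close>

lemma PU_expansion_subset:
  assumes PU: "PU Z \<eta> lower \<subseteq> lower" and nsd: "topspace Z - A \<notin> lower"
  shows "PU Z (\<xi> + \<eta>) (expansion Z \<xi> lower) \<subseteq> expansion Z \<xi> lower"
proof
  fix X assume "X \<in> PU Z (\<xi> + \<eta>) (expansion Z \<xi> lower)"
  then obtain B V where X: "X = (\<Union>n :: nat. B n \<inter> V n)" and B: "\<And>n. B n \<in> expansion Z \<xi> lower"
    and V: "\<And>n. V n \<in> Delta0 (1 + (\<xi> + \<eta>)) Z" and disj: "disjoint_family V" and cover: "(\<Union>n. V n) = topspace Z"
    unfolding PU_def by blast
  have "\<exists>f. Sigma0_measurable (1 + \<xi>) Z f \<and> B n = f -` A \<inter> topspace Z" for n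
    using B[of n] unfolding expansion_lower by blast
  then obtain f where f: "\<And>n. Sigma0_measurable (1 + \<xi>) Z (f n)" and Bf: "\<And>n. B n = f n -` A \<inter> topspace Z"
    by metis
  have "\<exists>\<D>. countable \<D> \<and> \<D> \<subseteq> Sigma0 (1 + \<xi>) Z \<and> coded_over \<D> \<eta> (V n)" for n
    using V[of n] by (intro Sigma0_add_coded_over) (simp add: Delta0_def)
  then obtain \<V> where \<V>: "\<And>n. countable (\<V> n)" "\<And>n. \<V> n \<subseteq> Sigma0 (1 + \<xi>) Z" "\<And>n. coded_over (\<V> n) \<eta> (V n)"
    by metis
  have "\<exists>\<D>. countable \<D> \<and> \<D> \<subseteq> Sigma0 (1 + \<xi>) Z \<and> coded_over \<D> \<eta> (topspace Z - V n)" for n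
    using V[of n] by (intro Sigma0_add_coded_over) (simp add: Delta0_def)
  then obtain \<W> where \<W>: "\<And>n. countable (\<W> n)" "\<And>n. \<W> n \<subseteq> Sigma0 (1 + \<xi>) Z"
      "\<And>n. coded_over (\<W> n) \<eta> (topspace Z - V n)"
    by metis
  define E where "E n i m = {x \<in> topspace Z. s (f n x) i = m}" for n i m
  \<comment> \<open>Besides the generators of each \<open>V n\<close> and of its complement, the
    coordinates of all \<open>f n\<close> are included, so that a code also determines every value
    \<open>f n x\<close>.\<close>
  define \<D> where "\<D> = (\<Union>n. \<V> n) \<union> (\<Union>n. \<W> n) \<union> (\<Union>n i m. {E n i m})"
  have \<D>: "countable \<D>" "\<D> \<subseteq> Sigma0 (1 + \<xi>) Z" "\<D> \<noteq> {}"
  proof -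
    show "countable \<D>"
      unfolding \<D>_def by (intro countable_Un countable_UN \<V>(1) \<W>(1)) auto
    have "E n i m \<in> Sigma0 (1 + \<xi>) Z" for n i m
      unfolding E_def by (rule Sigma0_coordinate[OF f])
    then show "\<D> \<subseteq> Sigma0 (1 + \<xi>) Z"
      unfolding \<D>_def using \<V>(2) \<W>(2) by blast
    show "\<D> \<noteq> {}" by (auto simp: \<D>_def)
  qed
  define D where "D = from_nat_into \<D>"
  have D: "D j \<in> \<D>" for j using from_nat_into[OF \<D>(3)] by (simp add: D_def)
  then have "D j \<in> Sigma0 (1 + \<xi>) Z" for j using \<D>(2) by blast
  then obtain c :: "'a \<Rightarrow> nat \<Rightarrow> nat"
    where c: "\<And>U. open U \<Longrightarrow> c -` U \<inter> topspace Z \<in> Sigma0 (1 + \<xi>) Z"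
      and c_D: "\<And>x j. x \<in> topspace Z \<Longrightarrow> (\<exists>k. c x k = Suc j) \<longleftrightarrow> x \<in> D j"
    by (rule Sigma0_enumeration) (rule that)
  define T where "T S = {c :: nat \<Rightarrow> nat. \<exists>j k. D j = S \<and> c k = Suc j}" for S
  have T: "open (T S)" for S unfolding T_def by (rule open_enumerates)
  have c_T: "x \<in> S \<longleftrightarrow> c x \<in> T S" if xZ: "x \<in> topspace Z" and S: "S \<in> \<D>" for x S
  proof -
    obtain j where "D j = S" using from_nat_into_surj[OF \<D>(1) S] unfolding D_def by blast
    then show ?thesis using c_D[OF xZ] unfolding T_def by blast
  qed
  have "\<exists>P\<in>Sigma0 (1 + \<eta>) euclidean. \<forall>x\<in>topspace Z. x \<in> V n \<longleftrightarrow> c x \<in> P" for n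
  proof -
    obtain P where P: "P \<in> Sigma0 (1 + \<eta>) euclidean"
      "\<forall>x\<in>topspace Z. \<forall>c. (\<forall>D\<in>\<V> n. x \<in> D \<longleftrightarrow> c \<in> T D) \<longrightarrow> (x \<in> V n \<longleftrightarrow> c \<in> P)"
      using \<V>(3)[of n, unfolded coded_over_def, THEN spec, of T] T by blast
    have "\<forall>D\<in>\<V> n. x \<in> D \<longleftrightarrow> c x \<in> T D" if "x \<in> topspace Z" for x
      using c_T[OF that] unfolding \<D>_def by blast
    with P show ?thesis by (intro bexI[of _ P]) simp_all
  qed
  then obtain P where P: "\<And>n. P n \<in> Sigma0 (1 + \<eta>) euclidean" "\<And>n x. x \<in> topspace Z \<Longrightarrow> x \<in> V n \<longleftrightarrow> c x \<in> P n"
    by metis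
  have "\<exists>Q\<in>Sigma0 (1 + \<eta>) euclidean. \<forall>x\<in>topspace Z. x \<in> topspace Z - V n \<longleftrightarrow> c x \<in> Q" for n
  proof -
    obtain Q where Q: "Q \<in> Sigma0 (1 + \<eta>) euclidean"
      "\<forall>x\<in>topspace Z. \<forall>c. (\<forall>D\<in>\<W> n. x \<in> D \<longleftrightarrow> c \<in> T D) \<longrightarrow> (x \<in> topspace Z - V n \<longleftrightarrow> c \<in> Q)"
      using \<W>(3)[of n, unfolded coded_over_def, THEN spec, of T] T by blast
    have "\<forall>D\<in>\<W> n. x \<in> D \<longleftrightarrow> c x \<in> T D" if "x \<in> topspace Z" for x
      using c_T[OF that] unfolding \<D>_def by blast
    with Q show ?thesis by (intro bexI[of _ Q]) simp_all
  qed
  then obtain Q where Q: "\<And>n. Q n \<in> Sigma0 (1 + \<eta>) euclidean"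
      "\<And>n x. x \<in> topspace Z \<Longrightarrow> x \<in> topspace Z - V n \<longleftrightarrow> c x \<in> Q n"
    by metis
  have [measurable]: "P n \<in> sets borel" "Q n \<in> sets borel" for n
    using Sigma0_borel P(1) Q(1) sets_borel_of_euclidean by blast+
  define N where "N c = (LEAST n. c \<in> P n)" for c
  define \<theta> where "\<theta> c = r (decode (\<lambda>i m. T (E (N c) i m)) c)" for c
  \<comment> \<open>\<open>P n\<close> and \<open>Q n\<close> are known to be complementary, and the
    \<open>P n\<close> to form a partition, only at codes of points. \<open>G\<close> imposes these
    properties, and the decodability of every \<open>f n\<close>, as Borel conditions.\<close>
  define G where "G = (\<Inter>n. decodable (\<lambda>i m. T (E n i m))) \<inter>
      {c. (\<forall>n. c \<in> P n \<longleftrightarrow> c \<notin> Q n) \<and> (\<exists>n. c \<in> P n \<and> (\<forall>n'. c \<in> P n' \<longrightarrow> n' = n))}"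
  have "{c \<in> space borel. (\<forall>n. c \<in> P n \<longleftrightarrow> c \<notin> Q n) \<and> (\<exists>n. c \<in> P n \<and> (\<forall>n'. c \<in> P n' \<longrightarrow> n' = n))} \<in> sets borel"
    by measurable
  then have G: "G \<in> sets borel"
    unfolding G_def by (intro sets.Int sets.countable_INT) (auto intro: borel_decodable T)
  have N_meas: "N \<in> borel \<rightarrow>\<^sub>M count_space UNIV"
    unfolding N_def by measurable
  have \<theta>: "\<theta> \<in> borel \<rightarrow>\<^sub>M borel_of Z"
    unfolding \<theta>_def
    by (rule measurable_compose[OF measurable_compose_countable[OF measurable_decode[OF T] N_meas] measurable_r])
  have N_eq: "N c = n" if "c \<in> G" "c \<in> P n" for c n
  proof -
    have "c \<in> P (N c)" unfolding N_def using that(2) by (rule LeastI)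
    moreover have "\<exists>n. \<forall>n'. c \<in> P n' \<longrightarrow> n' = n" using that(1) unfolding G_def by blast
    ultimately show ?thesis using that(2) by metis
  qed
  have c_G: "c x \<in> G" and c_\<theta>: "n = N (c x) \<Longrightarrow> \<theta> (c x) = f n x" if x: "x \<in> topspace Z" for x n
  proof -
    have cE: "c x \<in> T (E n i m) \<longleftrightarrow> s (f n x) i = m" for n i m
    proof -
      have "E n i m \<in> \<D>" unfolding \<D>_def by (rule UnI2) (simp, metis)
      from c_T[OF x this] show ?thesis using x by (simp add: E_def)
    qed
    have dec: "c x \<in> decodable (\<lambda>i m. T (E n i m))" "decode (\<lambda>i m. T (E n i m)) (c x) = s (f n x)" for n
      using decode_eqI[of "c x" "\<lambda>i m. T (E n i m)" "s (f n x)"] cE by auto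
    obtain n where "x \<in> V n" using cover x by blast
    moreover have "n' = n" if "x \<in> V n'" for n'
      using disj that \<open>x \<in> V n\<close> unfolding disjoint_family_on_def by blast
    ultimately have "\<exists>n. c x \<in> P n \<and> (\<forall>n'. c x \<in> P n' \<longrightarrow> n' = n)"
      using P(2)[OF x] by blast
    moreover have "c x \<in> P n \<longleftrightarrow> c x \<notin> Q n" for n
      using P(2)[OF x, of n] Q(2)[OF x, of n] x by blast
    ultimately show "c x \<in> G"
      unfolding G_def using dec(1) by simp
    have "f n x \<in> topspace Z" for n using f[of n] x by (auto simp: Sigma0_measurable_def)
    then show "n = N (c x) \<Longrightarrow> \<theta> (c x) = f n x" for n
      using dec(2) r_s by (simp add: \<theta>_def)
  qed
  have G_dec: "c \<in> decodable (\<lambda>i m. T (E n i m))" and G_PQ: "c \<in> P n \<longleftrightarrow> c \<notin> Q n"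
    and G_ex: "\<exists>n. c \<in> P n" if "c \<in> G" for c n
    using that unfolding G_def by blast+
  from G \<theta> show "X \<in> expansion Z \<xi> lower"
  proof (cases rule: reduction_dichotomy)
    case (1 F)
    have "x \<in> X \<longleftrightarrow> r (F (c x)) \<in> A" if x: "x \<in> topspace Z" for x
    proof -
      obtain n where n: "x \<in> V n" using cover x by blast
      then have nN: "n = N (c x)" using N_eq[OF c_G[OF x]] P(2)[OF x] by simp
      have "n' = n" if "x \<in> V n'" for n'
        using disj that n unfolding disjoint_family_on_def by blast
      then have "x \<in> X \<longleftrightarrow> x \<in> B n" using n unfolding X by blast
      also have "\<dots> \<longleftrightarrow> f n x \<in> A" using x by (simp add: Bf)
      also have "\<dots> \<longleftrightarrow> r (F (c x)) \<in> A"
        using 1(2)[OF c_G[OF x]] c_\<theta>[OF x nN] by simp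
      finally show ?thesis .
    qed
    moreover have "X \<subseteq> topspace Z" using X cover by blast
    ultimately have "X = (\<lambda>x. r (F (c x))) -` A \<inter> topspace Z" by blast
    then show ?thesis
      unfolding expansion_lower
      using Sigma0_measurable_compose_Baire[OF c compose_r[OF 1(1)]] by blast
  next
    case (2 F)
    \<comment> \<open>As \<open>F\<close> takes values in \<open>G\<close>, the coded combination
      pulls back to \<open>Z\<close> and exhibits the complement of \<open>A\<close> as a
      \<open>PU\<close> combination of level \<eta> over \<open>lower\<close>, contrary to
      \<open>PU\<close> and \<open>nsd\<close>.\<close>
    have sF: "continuous_map Z euclidean (\<lambda>x. F (s x))"
      using continuous_map_compose[OF cont_s 2(1)] by (simp add: comp_def)
    define B' where "B' n = (\<lambda>x. r (decode (\<lambda>i m. T (E n i m)) (F (s x)))) -` A \<inter> topspace Z" for n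
    define V' where "V' n = (\<lambda>x. F (s x)) -` P n \<inter> topspace Z" for n
    have eq: "x \<in> (\<Union>n. B' n \<inter> V' n) \<longleftrightarrow> x \<in> topspace Z - A" if x: "x \<in> topspace Z" for x
    proof -
      obtain n where n: "F (s x) \<in> P n" using G_ex[OF 2(2)] by blast
      have "x \<in> V' n' \<longleftrightarrow> n' = n" for n'
        using N_eq[OF 2(2) n] N_eq[OF 2(2), of "s x" n'] n x by (auto simp: V'_def)
      then have "x \<in> (\<Union>n. B' n \<inter> V' n) \<longleftrightarrow> x \<in> B' n" by simp
      also have "\<dots> \<longleftrightarrow> \<theta> (F (s x)) \<in> A"
        using N_eq[OF 2(2) n] x unfolding B'_def \<theta>_def by simp
      also have "\<dots> \<longleftrightarrow> x \<in> topspace Z - A"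
        using 2(3)[of "s x"] r_s x by simp
      finally show ?thesis .
    qed
    have "B' n \<in> lower" for n
    proof -
      have "continuous_map euclidean euclidean (\<lambda>y. decode (\<lambda>i m. T (E n i m)) (F y))"
        by (intro continuous_map_decode 2(1) T G_dec 2(2))
      from compose_r_s[OF this] show ?thesis unfolding lower_def B'_def by blast
    qed
    moreover have "V' n \<in> Delta0 (1 + \<eta>) Z" for n
    proof -
      have "(\<lambda>x. F (s x)) -` P n \<inter> topspace Z \<in> Sigma0 (1 + \<eta>) Z"
        "(\<lambda>x. F (s x)) -` Q n \<inter> topspace Z \<in> Sigma0 (1 + \<eta>) Z"
        by (intro Sigma0_continuous_vimage[OF sF] P(1) Q(1))+
      \<comment> \<open>On \<open>G\<close> the complement of \<open>P n\<close> is
        \<open>Q n\<close>, which bounds the class of the complement.\<close>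
      moreover have "topspace Z - V' n = (\<lambda>x. F (s x)) -` Q n \<inter> topspace Z"
        using G_PQ[OF 2(2), of _ n] unfolding V'_def by blast
      ultimately show ?thesis by (simp add: Delta0_def V'_def)
    qed
    moreover have "disjoint_family V'"
      unfolding disjoint_family_on_def
    proof (intro ballI impI)
      fix n n' :: nat assume "n \<noteq> n'"
      then have "x \<notin> V' n \<or> x \<notin> V' n'" for x
        using N_eq[OF 2(2), of "s x" n] N_eq[OF 2(2), of "s x" n'] by (auto simp: V'_def)
      then show "V' n \<inter> V' n' = {}" by blast
    qed
    moreover have "(\<Union>n. V' n) = topspace Z"
      using G_ex[OF 2(2)] unfolding V'_def by blast
    ultimately have "(\<Union>n. B' n \<inter> V' n) \<in> lower"
      using PU_memI[of B' lower V'] PU by blast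
    moreover have "(\<Union>n. B' n \<inter> V' n) = topspace Z - A"
    proof (rule set_eqI)
      show "x \<in> (\<Union>n. B' n \<inter> V' n) \<longleftrightarrow> x \<in> topspace Z - A" for x
        using eq[of x] by (cases "x \<in> topspace Z") (auto simp: V'_def)
    qed
    ultimately show ?thesis using nsd by simp
  qed
qed

text \<open>If the dichotomy yields no reduction of \<open>C\<close> to \<open>A\<close>, it reduces
  the complement of \<open>A\<close> to \<open>C\<close>; composed with a diagonal map
  \<open>u\<close>, this puts into the expansion a set that \<open>u\<close> was built to keep
  out.\<close>

lemma PU_subset_of_expansion:
  assumes unc: "uncountable (topspace Z)" and nsd: "topspace Z - A \<notin> lower"
    and PU: "PU Z (\<xi> + \<eta>) (expansion Z \<xi> lower) \<subseteq> expansion Z \<xi> lower"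
  shows "PU Z \<eta> lower \<subseteq> lower"
proof
  fix C assume "C \<in> PU Z \<eta> lower"
  then obtain B V where C: "C = (\<Union>n :: nat. B n \<inter> V n)" and B: "\<And>n. B n \<in> lower"
    and V: "\<And>n. V n \<in> Delta0 (1 + \<eta>) Z" and disj: "disjoint_family V" and cover: "(\<Union>n. V n) = topspace Z"
    unfolding PU_def by blast
  have "\<exists>f. continuous_map Z Z f \<and> B n = f -` A \<inter> topspace Z" for n
    using B[of n] unfolding lower_def by blast
  then obtain f where f: "\<And>n. continuous_map Z Z (f n)" and Bf: "\<And>n. B n = f n -` A \<inter> topspace Z"
    by metis
  define N where "N y = (LEAST n. r y \<in> V n)" for y
  \<comment> \<open>The reductions \<open>f n\<close> are glued along the partition into one Borel
    map, for which \<open>\<theta> y \<in> A\<close> expresses \<open>r y \<in> C\<close>.\<close>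
  define \<theta> where "\<theta> y = f (N y) (r y)" for y
  have N: "r y \<in> V (N y)" for y
  proof -
    have "\<exists>n. r y \<in> V n" using cover r_in[of y] by blast
    then show ?thesis unfolding N_def by (rule LeastI_ex)
  qed
  have [measurable]: "r -` V n \<in> sets borel" for n
    using measurable_sets[OF measurable_r, of "V n"] V[of n] Sigma0_borel[of "V n" _ Z]
    by (auto simp: Delta0_def)
  have "(\<lambda>y. LEAST n. y \<in> r -` V n) \<in> borel \<rightarrow>\<^sub>M count_space UNIV"
    by measurable
  then have N_meas: "N \<in> borel \<rightarrow>\<^sub>M count_space UNIV"
    by (simp add: N_def[abs_def])
  have "continuous_map euclidean Z (\<lambda>y. f n (r y))" for n
    using continuous_map_compose[OF cont_r f[of n]] by (simp add: comp_def)
  then have \<theta>: "\<theta> \<in> borel \<rightarrow>\<^sub>M borel_of Z"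
    unfolding \<theta>_def
    by (intro measurable_compose_countable[OF _ N_meas, of "\<lambda>n y. f n (r y)"] continuous_imp_borel)
  have \<theta>_iff: "\<theta> y \<in> A \<longleftrightarrow> r y \<in> C" for y
  proof -
    have "n = N y" if "r y \<in> V n" for n
      using N[of y] disj that unfolding disjoint_family_on_def by blast
    then show ?thesis using N[of y] r_in[of y] unfolding C Bf \<theta>_def by blast
  qed
  have C_sub: "C \<subseteq> topspace Z" using C cover by blast
  have "(UNIV :: (nat \<Rightarrow> nat) set) \<in> sets borel" by simp
  from this \<theta> show "C \<in> lower"
  proof (cases rule: reduction_dichotomy)
    case (1 F)
    have "C = (\<lambda>x. r (F (s x))) -` A \<inter> topspace Z"
      using C_sub 1(2) r_s \<theta>_iff by (auto simp flip: 1(2))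
    then show ?thesis unfolding lower_def using compose_r_s[OF 1(1)] by blast
  next
    case (2 F)
    define g where "g x = r (F (s x))" for x
    have g: "continuous_map Z Z g" unfolding g_def by (rule compose_r_s[OF 2(1)])
    have g_iff: "g x \<in> C \<longleftrightarrow> x \<notin> A" if "x \<in> topspace Z" for x
      using 2(3)[of "s x"] \<theta>_iff[of "F (s x)"] r_s[OF that] by (simp add: g_def)
    obtain u where u: "Sigma0_measurable (1 + \<xi>) Z u"
      and diag: "\<And>v. Sigma0_measurable (1 + \<xi>) Z v \<Longrightarrow>
        u -` (topspace Z - A) \<inter> topspace Z \<noteq> v -` A \<inter> topspace Z"
      by (rule expansion_diagonal[OF unc nsd, of \<xi>]) (rule that)
    have u_in: "u x \<in> topspace Z" if "x \<in> topspace Z" for x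
      using u that by (auto simp: Sigma0_measurable_def)
    have g_in: "g x \<in> topspace Z" for x by (simp add: g_def r_in)
    \<comment> \<open>Composition with \<open>u\<close> raises the partition from class
      \<open>1 + \<eta>\<close> to \<open>1 + (\<xi> + \<eta>)\<close> and carries members of
      \<open>lower\<close> into the expansion.\<close>
    define B' where "B' n = u -` ((\<lambda>x. f n (g x)) -` A \<inter> topspace Z) \<inter> topspace Z" for n
    define V' where "V' n = (\<lambda>x. g (u x)) -` V n \<inter> topspace Z" for n
    have "B' n \<in> expansion Z \<xi> lower" for n
    proof -
      have "continuous_map Z Z (\<lambda>x. f n (g x))"
        using continuous_map_compose[OF g f[of n]] by (simp add: comp_def)
      then have "(\<lambda>x. f n (g x)) -` A \<inter> topspace Z \<in> lower" unfolding lower_def by blast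
      with u show ?thesis unfolding expansion_def B'_def by blast
    qed
    moreover have "V' n \<in> Delta0 (1 + (\<xi> + \<eta>)) Z" for n
    proof -
      have meas: "(\<lambda>x. g (u x)) -` U \<inter> topspace Z \<in> Sigma0 (1 + \<xi>) Z" if "openin Z U" for U
      proof -
        have "u -` (g -` U \<inter> topspace Z) \<inter> topspace Z \<in> Sigma0 (1 + \<xi>) Z"
          by (intro Sigma0_measurable_vimage[OF u] continuous_map_vimage_open[OF g] that)
        moreover have "u -` (g -` U \<inter> topspace Z) \<inter> topspace Z = (\<lambda>x. g (u x)) -` U \<inter> topspace Z"
          using u_in by auto
        ultimately show ?thesis by simp
      qed
      have "(\<lambda>x. g (u x)) \<in> topspace Z \<rightarrow> topspace Z" using g_in by blast
      moreover have "V n \<in> Sigma0 (1 + \<eta>) Z" "topspace Z - V n \<in> Sigma0 (1 + \<eta>) Z"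
        using V[of n] by (simp_all add: Delta0_def)
      ultimately have "(\<lambda>x. g (u x)) -` V n \<inter> topspace Z \<in> Sigma0 (1 + (\<xi> + \<eta>)) Z"
        "(\<lambda>x. g (u x)) -` (topspace Z - V n) \<inter> topspace Z \<in> Sigma0 (1 + (\<xi> + \<eta>)) Z"
        using Sigma0_vimage[OF _ meas] by blast+
      moreover have "topspace Z - V' n = (\<lambda>x. g (u x)) -` (topspace Z - V n) \<inter> topspace Z"
        using g_in by (auto simp: V'_def)
      ultimately show ?thesis by (simp add: Delta0_def V'_def)
    qed
    moreover have "disjoint_family V'"
      using disj unfolding disjoint_family_on_def V'_def by blast
    moreover have "\<exists>n. g (u x) \<in> V n" for x
      using cover g_in[of "u x"] by blast
    then have "(\<Union>n. V' n) = topspace Z" by (auto simp: V'_def)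
    ultimately have "(\<Union>n. B' n \<inter> V' n) \<in> expansion Z \<xi> lower"
      using PU_memI[of B' "expansion Z \<xi> lower" V'] PU by blast
    moreover have "(\<Union>n. B' n \<inter> V' n) = u -` (topspace Z - A) \<inter> topspace Z"
    proof -
      have "(\<Union>n. B' n \<inter> V' n) = {x \<in> topspace Z. g (u x) \<in> C}"
        using u_in g_in by (auto simp: B'_def V'_def C Bf)
      also have "\<dots> = u -` (topspace Z - A) \<inter> topspace Z"
        using u_in g_iff by auto
      finally show ?thesis .
    qed
    ultimately have "u -` (topspace Z - A) \<inter> topspace Z \<in> expansion Z \<xi> lower" by (simp only:)
    then obtain v where "Sigma0_measurable (1 + \<xi>) Z v"
      "u -` (topspace Z - A) \<inter> topspace Z = v -` A \<inter> topspace Z"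
      unfolding expansion_lower mem_Collect_eq by (elim exE conjE)
    with diag show ?thesis by blast
  qed
qed

text \<open>The partition whose pieces after the first are all empty is admissible at every
  level.\<close>

lemma PU_superset:
  assumes "\<And>B. B \<in> \<Gamma> \<Longrightarrow> B \<subseteq> topspace Z"
  shows "\<Gamma> \<subseteq> PU Z \<xi> \<Gamma>"
proof
  fix B assume B: "B \<in> \<Gamma>"
  define V where "V n = (if n = 0 then topspace Z else {})" for n :: nat
  have "(\<Union>n. B \<inter> V n) \<in> PU Z \<xi> \<Gamma>"
    using B by (intro PU_memI)
      (auto simp: V_def Delta0_def disjoint_family_on_def le_add_right_omega1 intro: Sigma0_openin split: if_splits)
  moreover have "(\<Union>n. B \<inter> V n) = B"
    using assms[OF B] by (auto simp: V_def split: if_splits)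
  ultimately show "B \<in> PU Z \<xi> \<Gamma>" by simp
qed

lemma level_ge_expansion_iff:
  assumes "uncountable (topspace Z)" "topspace Z - A \<notin> lower"
  shows "level_ge Z (expansion Z \<xi> lower) (\<xi> + \<eta>) \<longleftrightarrow> level_ge Z lower \<eta>"
proof -
  have "lower \<subseteq> PU Z \<eta> lower"
    by (rule PU_superset) (auto simp: lower_def)
  moreover have "expansion Z \<xi> lower \<subseteq> PU Z (\<xi> + \<eta>) (expansion Z \<xi> lower)"
    by (rule PU_superset) (auto simp: expansion_def)
  ultimately show ?thesis
    using PU_expansion_subset[OF _ assms(2)] PU_subset_of_expansion[OF assms]
    unfolding level_ge_def by (metis subset_antisym order_refl)
qed

end

section \<open>Deduction of the level formula\<close>

theorem corollary3p24:
  fixes \<Sigma> :: "'a topology \<Rightarrow> 'a set set"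
    and Z :: "'a topology"
    and \<Gamma> :: "'a set set"
    and \<xi> \<eta> :: omega1
  assumes "nice_pointclass \<Sigma>"
    and "Det (baire_sets \<Sigma>)"
    and "polish Z" and "zero_dimensional Z" and "uncountable (topspace Z)"
    and "\<Gamma> \<in> NSD_in \<Sigma> Z"
    and "level_eq Z \<Gamma> \<eta>"
  shows "level_eq Z (expansion Z \<xi> \<Gamma>) (\<xi> + \<eta>)"
proof -
  obtain s r where "Baire_retract Z s r"
    using polish_Baire_retract assms(3,4) by blast
  then interpret Baire_retract Z s r .
  obtain p :: "'a \<Rightarrow> nat \<Rightarrow> bool" where p: "\<And>e. \<exists>x\<in>topspace Z. p x = e"
    using Cantor_surjection[OF assms(5)] by metis
  \<comment> \<open>The graph of a sequence is a point of the Cantor space, hence a value of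
    \<open>p\<close>; choosing a preimage injects the Baire space into the type of
    \<open>Z\<close>.\<close>
  define graph where "graph y = (\<lambda>k. y (fst (prod_decode k)) = snd (prod_decode k))" for y :: "nat \<Rightarrow> nat"
  define b where "b y = (SOME x. p x = graph y)" for y
  have pb: "p (b y) = graph y" for y
    unfolding b_def using p by (metis (mono_tags, lifting) someI_ex)
  have "inj b"
  proof
    fix y y' assume "b y = b y'"
    then have "graph y = graph y'" using pb by metis
    then have "graph y (prod_encode (i, y i)) = graph y' (prod_encode (i, y i))" for i by simp
    then have "y' i = y i" for i by (simp add: graph_def)
    then show "y = y'" by auto
  qed
  from assms(6) obtain A where A: "A \<subseteq> topspace Z"
    and \<Gamma>: "\<Gamma> = {f -` A \<inter> topspace Z | f. continuous_map Z Z f}"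
    and dual: "\<Gamma> \<noteq> dual_class Z \<Gamma>" and \<Gamma>_sub: "\<Gamma> \<subseteq> \<Sigma> Z"
    unfolding NSD_in_def NSD_def wadge_class_def by blast
  have "(\<lambda>x. x) -` A \<inter> topspace Z \<in> \<Gamma>"
    unfolding \<Gamma> by (intro CollectI exI[of _ "\<lambda>x. x"]) simp
  then have "A \<in> \<Gamma>" using A by (simp add: Int_absorb2)
  then have A_\<Sigma>: "A \<in> \<Sigma> Z" using \<Gamma>_sub by blast
  have sep: "sep_metrizable Z"
    using assms(3) completely_metrizable_imp_metrizable_space unfolding polish_def sep_metrizable_def by blast
  obtain \<S> where \<S>: "\<And>S. S \<in> \<S> \<Longrightarrow> determined S" "algebra UNIV \<S>" "sets borel \<subseteq> \<S>"
      "\<And>\<phi>. \<phi> \<in> borel \<rightarrow>\<^sub>M borel_of Z \<Longrightarrow> \<phi> -` A \<in> \<S>"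
    by (rule determined_family[OF assms(1,2) sep A_\<Sigma> \<open>inj b\<close>]) (rule that)
  interpret determined_retract Z s r A \<S>
    by (intro determined_retract.intro determined_retract_axioms.intro Baire_retract_axioms A \<S>)
  have lower: "lower = \<Gamma>" unfolding lower_def \<Gamma> ..
  \<comment> \<open>Otherwise composing reductions would put every complement of a member of
    \<Gamma> into \<Gamma>, making it selfdual.\<close>
  have "topspace Z - A \<notin> \<Gamma>"
  proof
    assume "topspace Z - A \<in> \<Gamma>"
    then obtain g where g: "continuous_map Z Z g" and gA: "topspace Z - A = g -` A \<inter> topspace Z"
      unfolding \<Gamma> by blast
    have compl: "topspace Z - B \<in> \<Gamma>" if B_in: "B \<in> \<Gamma>" for B
    proof -
      obtain f where f: "continuous_map Z Z f" and B: "B = f -` A \<inter> topspace Z"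
        using B_in unfolding \<Gamma> by blast
      have "f x \<in> topspace Z" if "x \<in> topspace Z" for x
        using f that by (auto simp: continuous_map_def)
      moreover have "g x \<in> A \<longleftrightarrow> x \<notin> A" if "x \<in> topspace Z" for x
        using gA that by blast
      ultimately have "topspace Z - B = (g \<circ> f) -` A \<inter> topspace Z"
        unfolding B by auto
      then show ?thesis unfolding \<Gamma> using continuous_map_compose[OF f g] by blast
    qed
    have "\<Gamma> = dual_class Z \<Gamma>"
    proof (intro equalityI subsetI)
      fix B assume B: "B \<in> \<Gamma>"
      then have "B = topspace Z - (topspace Z - B)" unfolding \<Gamma> by blast
      with compl[OF B] show "B \<in> dual_class Z \<Gamma>" unfolding dual_class_def by blast
    next
      fix B assume "B \<in> dual_class Z \<Gamma>"
      then obtain C where "B = topspace Z - C" "C \<in> \<Gamma>" unfolding dual_class_def by blast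
      then show "B \<in> \<Gamma>" using compl by simp
    qed
    with dual show False ..
  qed
  \<comment> \<open>The instances used are \<open>\<delta> = \<eta>\<close> and
    \<open>\<delta> = \<eta> + 1\<close>, the latter because
    \<open>\<xi> + (\<eta> + 1) = (\<xi> + \<eta>) + 1\<close>.\<close>
  then have "level_ge Z (expansion Z \<xi> \<Gamma>) (\<xi> + \<delta>) \<longleftrightarrow> level_ge Z \<Gamma> \<delta>" for \<delta>
    using level_ge_expansion_iff[OF assms(5)] unfolding lower by blast
  with assms(7) show ?thesis
    unfolding level_eq_def plus_succ_omega1[symmetric] by blast
qed

end
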